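(* Let $u,v\in\mathcal{H}_n$ be real. If $\nu(u,v)$ is finite, then $$\nu(u,v)\leq 2n^2 .$$
   Context: $\mathcal{H}_n$ is the space of complex-valued harmonic homogeneous polynomials of degree $n$ on $\mathbb{R}^3$, also viewed as functions on the unit sphere $\mathbb{S}^2\subset\mathbb{R}^3$; $u\in\mathcal{H}_n$ is real if it takes real values on $\mathbb{R}^3$. $N_u=\{x\in\mathbb{S}^2:u(x)=0\}$. $\nu(u,v)$ is the number of points of $N_u\cap N_v$, counted with multiplicities as follows: the multiplicity of a zero $x\in\mathbb{S}^2$ of a nonzero real $u\in\mathcal{H}_n$ is the number of smooth nodal lines of $u$ which meet at $x$ (equivalently, the vanishing order of $u$ at $x$), and a common zero at which $u,v$ have multiplicities $k,l$ is counted $kl$ times. If $u,v$ are regular (zero is not a critical value of $u|_{\mathbb{S}^2}$, nor of $v|_{\mathbb{S}^2}$), then $\nu(u,v)=\operatorname{card}(N_u\cap N_v)$. If $N_u\cap N_v$ is infinite, then $\nu(u,v)=\infty$. *)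

theory Defs
  imports "HOL-Analysis.Analysis" "HOL-Library.Extended_Nat"
begin

definition multi_indices :: "nat \<Rightarrow> (3 \<Rightarrow> nat) set" where
  "multi_indices n = {a. (\<Sum>i\<in>UNIV. a i) = n}"

lemma finite_multi_indices: "finite (multi_indices n)"
proof (rule finite_subset)
  show "multi_indices n \<subseteq> PiE UNIV (\<lambda>_. {..n})"
    unfolding multi_indices_def by (auto intro: member_le_sum)
  show "finite (PiE (UNIV :: 3 set) (\<lambda>_. {..n}))"
    by (intro finite_PiE) auto
qed

definition homogeneous_polynomial :: "nat \<Rightarrow> (real^3 \<Rightarrow> complex) \<Rightarrow> bool" where
  "homogeneous_polynomial n u \<longleftrightarrow>
     (\<exists>c :: (3 \<Rightarrow> nat) \<Rightarrow> complex. \<forall>x.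
        u x = (\<Sum>a\<in>multi_indices n. c a * complex_of_real (\<Prod>i\<in>UNIV. (x $ i) ^ a i)))"

definition partial_derivative :: "3 \<Rightarrow> (real^3 \<Rightarrow> complex) \<Rightarrow> real^3 \<Rightarrow> complex" where
  "partial_derivative i u x = vector_derivative (\<lambda>t. u (x + t *\<^sub>R axis i 1)) (at 0)"

definition laplacian :: "(real^3 \<Rightarrow> complex) \<Rightarrow> real^3 \<Rightarrow> complex" where
  "laplacian u x = (\<Sum>i\<in>UNIV. partial_derivative i (partial_derivative i u) x)"

definition harmonic_polynomials :: "nat \<Rightarrow> (real^3 \<Rightarrow> complex) set" where
  "harmonic_polynomials n = {u. homogeneous_polynomial n u \<and> (\<forall>x. laplacian u x = 0)}"

definition real_valued :: "(real^3 \<Rightarrow> complex) \<Rightarrow> bool" where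
  "real_valued u \<longleftrightarrow> (\<forall>x. u x \<in> \<real>)"

definition nodal_set :: "(real^3 \<Rightarrow> complex) \<Rightarrow> (real^3) set" where
  "nodal_set u = {x \<in> sphere 0 1. u x = 0}"

text \<open>The vanishing order is the least order of a partial derivative that does not vanish at the
  point. Derivatives are taken in the ambient space; since a homogeneous \<open>u\<close> is determined along
  each ray by its value on the sphere, this is also the vanishing order of the restriction of
  \<open>u\<close> to the sphere. The value is unspecified if all derivatives vanish, which for a
  polynomial means \<open>u = 0\<close>.\<close>

definition vanishing_order :: "(real^3 \<Rightarrow> complex) \<Rightarrow> real^3 \<Rightarrow> nat" where
  "vanishing_order u x = (LEAST k. \<exists>js. length js = k \<and> foldr partial_derivative js u x \<noteq> 0)"

text \<open>The unspecified order of \<open>u = 0\<close> plays no role below for real harmonic homogeneous polynomials of the same degree: if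
  one of them is zero, their common nodal set on the sphere is either infinite or (in degree 0) empty.\<close>

definition common_zero_count :: "(real^3 \<Rightarrow> complex) \<Rightarrow> (real^3 \<Rightarrow> complex) \<Rightarrow> enat" where
  "common_zero_count u v =
     (if finite (nodal_set u \<inter> nodal_set v)
      then enat (\<Sum>x\<in>nodal_set u \<inter> nodal_set v. vanishing_order u x * vanishing_order v x)
      else \<infinity>)"

end

theory Submission
  imports Defs "HOL-Probability.Distributions" "HOL-Computational_Algebra.Polynomial_Factorial"
    "HOL-Computational_Algebra.Field_as_Ring"
begin

text \<open>
  The bound is Bezout's inequality with multiplicities in the real projective plane, each projective
  point being counted twice on the sphere.

  Bezout's inequality is a count of dimensions. Let \<open>p\<close> run through representatives of the common
  zeros, with multiplicities \<open>k\<close>, \<open>l\<close>, and take \<open>D\<close> large. For forms \<open>a\<close>, \<open>b\<close> of degree \<open>D\<close>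
  that vanish at each \<open>p\<close> to order \<open>l\<close> and \<open>k\<close>, respectively, \<open>u a + v b\<close> vanishes to order
  \<open>k + l\<close>, so it is linearly independent of forms whose jets of order less than \<open>k + l\<close> at the
  points \<open>p\<close> are independent. Since vanishing to order \<open>j\<close> at a point amounts to
  \<open>j (j + 1) / 2\<close> linear conditions, and the relations \<open>u a + v b = 0\<close> are the multiples of
  \<open>(v, -u)\<close> if \<open>u\<close> and \<open>v\<close> are coprime, comparing dimensions gives \<open>\<Sum>k l \<le> n\<^sup>2\<close>.

  Coprimality follows from harmonicity: a common factor \<open>w\<close> of positive degree would have finitely
  many zeros on the sphere, hence constant sign. If \<open>u = w f\<close>, then \<open>u f = w f\<^sup>2\<close> has constant sign,
  but its Gaussian integral is zero, because a harmonic form is orthogonal to all forms of lower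
  degree.
\<close>

section \<open>Real forms in three variables\<close>

definition mon :: "(3 \<Rightarrow> nat) \<Rightarrow> real^3 \<Rightarrow> real" where
  "mon a x = (\<Prod>i\<in>UNIV. (x $ i) ^ a i)"

definition form :: "nat \<Rightarrow> ((3 \<Rightarrow> nat) \<Rightarrow> real) \<Rightarrow> real^3 \<Rightarrow> real" where
  "form n c x = (\<Sum>a\<in>multi_indices n. c a * mon a x)"

definition forms :: "nat \<Rightarrow> (real^3 \<Rightarrow> real) set" where
  "forms n = range (form n)"

lemma mon_3: "mon a x = (x $ 1) ^ a 1 * (x $ 2) ^ a 2 * (x $ 3) ^ a 3"
  unfolding mon_def UNIV_3 by simp

lemma mem_multi_indices: "a \<in> multi_indices n \<longleftrightarrow> a 1 + a 2 + a 3 = n"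
  unfolding multi_indices_def by (simp add: sum_3)

lemma form_in_forms [intro, simp]: "form n c \<in> forms n"
  by (simp add: forms_def)

lemma formsE:
  assumes "f \<in> forms n"
  obtains c where "f = form n c"
  using assms by (auto simp: forms_def)

lemma forms_add: "f \<in> forms n \<Longrightarrow> g \<in> forms n \<Longrightarrow> (\<lambda>x. f x + g x) \<in> forms n"
proof -
  assume "f \<in> forms n" "g \<in> forms n"
  then obtain c d where "f = form n c" "g = form n d" by (auto elim!: formsE)
  then have "(\<lambda>x. f x + g x) = form n (\<lambda>a. c a + d a)"
    by (auto simp: form_def algebra_simps sum.distrib fun_eq_iff)
  then show ?thesis by simp
qed

lemma forms_scale: "f \<in> forms n \<Longrightarrow> (\<lambda>x. r * f x) \<in> forms n"
proof -
  assume "f \<in> forms n"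
  then obtain c where "f = form n c" by (auto elim!: formsE)
  then have "(\<lambda>x. r * f x) = form n (\<lambda>a. r * c a)"
    by (auto simp: form_def algebra_simps sum_distrib_left fun_eq_iff)
  then show ?thesis by simp
qed

lemma forms_zero: "(\<lambda>x. 0) \<in> forms n"
proof -
  have "(\<lambda>x. 0) = form n (\<lambda>a. 0)" by (auto simp: form_def)
  then show ?thesis by simp
qed

lemma forms_sum: "(\<And>i. i \<in> I \<Longrightarrow> f i \<in> forms n) \<Longrightarrow> (\<lambda>x. \<Sum>i\<in>I. f i x) \<in> forms n"
  by (induction I rule: infinite_finite_induct) (auto intro: forms_add forms_zero)

lemma mon_in_forms: "a \<in> multi_indices n \<Longrightarrow> mon a \<in> forms n"
proof -
  assume a: "a \<in> multi_indices n"
  have "mon a = form n (\<lambda>b. if b = a then 1 else 0)"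
  proof
    fix x
    have "form n (\<lambda>b. if b = a then 1 else 0) x = (\<Sum>b\<in>multi_indices n. if b = a then mon b x else 0)"
      unfolding form_def by (intro sum.cong) auto
    then show "mon a x = form n (\<lambda>b. if b = a then 1 else 0) x"
      using a finite_multi_indices[of n] by simp
  qed
  then show ?thesis by simp
qed

text \<open>Reduces linear statements about forms, such as Euler's relation and Gaussian integration
  by parts, to monomials.\<close>

lemma forms_induct [consumes 1, case_names mon add scale zero]:
  assumes "f \<in> forms n"
    and "\<And>a. a \<in> multi_indices n \<Longrightarrow> P (mon a)"
    and add: "\<And>f g. f \<in> forms n \<Longrightarrow> g \<in> forms n \<Longrightarrow> P f \<Longrightarrow> P g \<Longrightarrow> P (\<lambda>x. f x + g x)"
    and "\<And>r f. f \<in> forms n \<Longrightarrow> P f \<Longrightarrow> P (\<lambda>x. r * f x)"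
    and "P (\<lambda>x. 0)"
  shows "P f"
proof -
  obtain c where f: "f = form n c" using assms(1) by (rule formsE)
  have "(\<lambda>x. \<Sum>a\<in>A. c a * mon a x) \<in> forms n \<and> P (\<lambda>x. \<Sum>a\<in>A. c a * mon a x)"
    if "A \<subseteq> multi_indices n" for A
    using finite_subset[OF that finite_multi_indices] that
    by (induction A rule: finite_induct)
      (auto intro!: assms forms_zero forms_add forms_scale mon_in_forms)
  then show ?thesis by (simp add: f form_def[abs_def])
qed

lemma mon_mult: "mon a x * mon b x = mon (\<lambda>i. a i + b i) x"
  by (simp add: mon_def power_add prod.distrib)

lemma forms_mult:
  assumes "f \<in> forms m" "g \<in> forms n"
  shows "(\<lambda>x. f x * g x) \<in> forms (m + n)"
  using assms(1)
proof (induction rule: forms_induct)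
  case (mon a)
  from assms(2) show ?case
  proof (induction rule: forms_induct)
    case (mon b)
    then show ?case using \<open>a \<in> multi_indices m\<close>
      by (auto simp: mon_mult mem_multi_indices intro!: mon_in_forms)
  next
    case (add f g) then show ?case by (auto simp: distrib_left intro: forms_add)
  next
    case (scale r f) then show ?case
      using forms_scale[of "\<lambda>x. mon a x * f x" _ r] by (simp add: mult.left_commute)
  qed (simp add: forms_zero)
next
  case (add f g) then show ?case by (auto simp: distrib_right intro: forms_add)
next
  case (scale r f) then show ?case
    using forms_scale[of "\<lambda>x. f x * g x" _ r] by (simp add: mult.assoc)
qed (simp add: forms_zero)

lemma mon_scale: "a \<in> multi_indices n \<Longrightarrow> mon a (t *\<^sub>R x) = t ^ n * mon a x"
  by (auto simp: mon_3 mem_multi_indices power_mult_distrib power_add)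

lemma forms_homogeneous:
  assumes "f \<in> forms n" shows "f (t *\<^sub>R x) = t ^ n * f x"
  using assms by (induction rule: forms_induct) (auto simp: mon_scale algebra_simps)

lemma forms_const: "(\<lambda>x. r) \<in> forms 0"
proof -
  have "mon (\<lambda>i. 0) = (\<lambda>x. 1)" by (auto simp: mon_def)
  moreover have "mon (\<lambda>i. 0) \<in> forms 0" by (rule mon_in_forms) (simp add: mem_multi_indices)
  ultimately show ?thesis using forms_scale[of "mon (\<lambda>i. 0)" 0 r] by simp
qed

lemma forms_coord: "(\<lambda>x. x $ i) \<in> forms 1"
proof -
  have "mon (\<lambda>j. if j = i then 1 else 0) x = x $ i" for x
    by (simp add: mon_def if_distrib[of "\<lambda>r. _ ^ r"] cong: if_cong)
  then have "mon (\<lambda>j. if j = i then 1 else 0) = (\<lambda>x. x $ i)" by auto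
  moreover have "(\<lambda>j. if j = i then 1 else 0) \<in> multi_indices 1"
    by (simp add: multi_indices_def)
  ultimately show ?thesis using mon_in_forms by metis
qed

lemma forms_inner: "(\<lambda>x. x \<bullet> y) \<in> forms 1"
proof -
  have "(\<lambda>x. x \<bullet> y) = (\<lambda>x. \<Sum>i\<in>UNIV. y $ i * x $ i)" by (auto simp: inner_vec_def mult.commute)
  then show ?thesis by (simp only:) (intro forms_sum forms_scale forms_coord)
qed

lemma forms_power: "f \<in> forms m \<Longrightarrow> (\<lambda>x. f x ^ k) \<in> forms (m * k)"
  by (induction k) (auto intro: forms_const dest: forms_mult simp: add.commute)

lemma forms_prod:
  "finite I \<Longrightarrow> (\<And>i. i \<in> I \<Longrightarrow> f i \<in> forms (d i)) \<Longrightarrow> (\<lambda>x. \<Prod>i\<in>I. f i x) \<in> forms (\<Sum>i\<in>I. d i)"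
  by (induction I rule: finite_induct) (auto intro: forms_const forms_mult)

lemma forms_degree_0: "f \<in> forms 0 \<Longrightarrow> f x = f y"
  by (induction rule: forms_induct) (auto simp: mon_3 mem_multi_indices)

lemma continuous_on_forms:
  assumes "f \<in> forms n" shows "continuous_on A f"
  using assms by (induction rule: forms_induct) (auto simp: mon_def[abs_def] intro!: continuous_intros)

section \<open>Dehomogenisation\<close>

text \<open>A \<open>real poly poly\<close> is a polynomial in \<open>x\<close> and \<open>y\<close>, with \<open>x\<close> the variable of the coefficients.\<close>

definition eval2 :: "real poly poly \<Rightarrow> real \<Rightarrow> real \<Rightarrow> real" where
  "eval2 p x y = poly (poly p [:y:]) x"

text \<open>A bound and not an exact degree, because a form divisible by \<open>x $ 3\<close> loses
  degree in the affine chart.\<close>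

definition tdeg_le :: "nat \<Rightarrow> real poly poly \<Rightarrow> bool" where
  "tdeg_le n p \<longleftrightarrow> (\<forall>i j. n < i + j \<longrightarrow> coeff (coeff p j) i = 0)"

text \<open>Restriction to the chart \<open>x $ 3 = 1\<close>. The polynomial is determined by the
  form, but the form by the polynomial only once its degree is fixed.\<close>

definition dehom :: "(real^3 \<Rightarrow> real) \<Rightarrow> real poly poly \<Rightarrow> bool" where
  "dehom f p \<longleftrightarrow> (\<forall>x y. f (vector [x, y, 1]) = eval2 p x y)"

definition dehom_poly :: "nat \<Rightarrow> ((3 \<Rightarrow> nat) \<Rightarrow> real) \<Rightarrow> real poly poly" where
  "dehom_poly n c = (\<Sum>a\<in>multi_indices n. monom (monom (c a) (a 1)) (a 2))"

definition multi_index :: "nat \<Rightarrow> nat \<Rightarrow> nat \<Rightarrow> 3 \<Rightarrow> nat" where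
  "multi_index n i j = (\<lambda>k. if k = 1 then i else if k = 2 then j else n - (i + j))"

lemma multi_index_simps [simp]: "multi_index n i j 1 = i" "multi_index n i j 2 = j" "multi_index n i j 3 = n - (i + j)"
  by (simp_all add: multi_index_def)

lemma multi_index_eta: "a \<in> multi_indices n \<Longrightarrow> a = multi_index n (a 1) (a 2)"
  by (auto simp: mem_multi_indices fun_eq_iff forall_3)

lemma coeff_dehom_poly: "coeff (coeff (dehom_poly n c) j) i = (if i + j \<le> n then c (multi_index n i j) else 0)"
proof -
  have "coeff (coeff (dehom_poly n c) j) i
      = (\<Sum>a\<in>multi_indices n. if a 1 = i \<and> a 2 = j then c a else 0)"
    unfolding dehom_poly_def coeff_sum by (intro sum.cong) auto
  also have "\<dots> = (\<Sum>a\<in>multi_indices n. if a = multi_index n i j then (if i + j \<le> n then c a else 0) else 0)"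
    by (intro sum.cong refl) (auto simp: fun_eq_iff forall_3 mem_multi_indices)
  also have "\<dots> = (if i + j \<le> n then c (multi_index n i j) else 0)"
    using finite_multi_indices[of n] by (auto simp: mem_multi_indices)
  finally show ?thesis .
qed

lemma eval2_add: "eval2 (p + q) x y = eval2 p x y + eval2 q x y" by (simp add: eval2_def)
lemma eval2_mult: "eval2 (p * q) x y = eval2 p x y * eval2 q x y" by (simp add: eval2_def)
lemma eval2_uminus: "eval2 (- p) x y = - eval2 p x y" by (simp add: eval2_def)
lemma eval2_sum: "eval2 (\<Sum>i\<in>I. p i) x y = (\<Sum>i\<in>I. eval2 (p i) x y)" by (simp add: eval2_def poly_sum)
lemma eval2_monom: "eval2 (monom (monom r i) j) x y = r * x ^ i * y ^ j"
  by (simp add: eval2_def poly_monom power_mult_distrib)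

text \<open>For fixed \<open>y\<close>, agreement for all \<open>x\<close> makes
  \<open>p - q\<close> vanish at the constant \<open>[:y:]\<close>. These are infinitely many roots
  in the domain \<open>real poly\<close>.\<close>

lemma eval2_inject:
  assumes "\<And>x y. eval2 p x y = eval2 q x y" shows "p = q"
proof -
  have 1: "poly p [:y:] = poly q [:y:]" for y
    using assms by (intro poly_ext) (simp add: eval2_def)
  have "infinite (range (\<lambda>y::real. [:y:]))"
    using finite_imageD[of "\<lambda>y::real. [:y:]" UNIV] infinite_UNIV_char_0[where 'a=real]
    by (auto simp: inj_on_def)
  moreover have "range (\<lambda>y::real. [:y:]) \<subseteq> {z. poly (p - q) z = 0}" using 1 by auto
  ultimately have "infinite {z. poly (p - q) z = 0}" using finite_subset by blast
  then have "p - q = 0" using poly_roots_finite by blast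
  then show ?thesis by simp
qed

lemma dehom_unique: "dehom f p \<Longrightarrow> dehom f q \<Longrightarrow> p = q"
  by (rule eval2_inject) (metis dehom_def)

lemma dehom_mult: "dehom f p \<Longrightarrow> dehom g q \<Longrightarrow> dehom (\<lambda>x. f x * g x) (p * q)"
  by (simp add: dehom_def eval2_mult)

lemma dehom_add: "dehom f p \<Longrightarrow> dehom g q \<Longrightarrow> dehom (\<lambda>x. f x + g x) (p + q)"
  by (simp add: dehom_def eval2_add)

lemma dehom_zero: "dehom (\<lambda>x. 0) 0"
  by (simp add: dehom_def eval2_def)

lemma dehom_form: "dehom (form n c) (dehom_poly n c)"
  by (auto simp: dehom_def form_def mon_3 dehom_poly_def eval2_sum eval2_monom vector_3 mult.assoc)

lemma tdeg_le_dehom_poly: "tdeg_le n (dehom_poly n c)"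
  by (simp add: tdeg_le_def coeff_dehom_poly)

lemma forms_dehomE:
  assumes "f \<in> forms n" obtains p where "tdeg_le n p" "dehom f p"
  using assms dehom_form tdeg_le_dehom_poly by (metis formsE)

lemma tdeg_le_homE:
  assumes "tdeg_le n p" obtains f where "f \<in> forms n" "dehom f p"
proof -
  have "p = dehom_poly n (\<lambda>a. coeff (coeff p (a 2)) (a 1))"
    using assms by (intro poly_eqI) (auto simp: coeff_dehom_poly tdeg_le_def)
  then show ?thesis using that dehom_form form_in_forms by metis
qed

lemma form_zero_coeff:
  assumes "\<And>x. form n c x = 0" "a \<in> multi_indices n" shows "c a = 0"
proof -
  have "dehom (form n c) 0" using assms(1) by (simp add: dehom_def eval2_def)
  then have "dehom_poly n c = 0" using dehom_form dehom_unique by blast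
  then have "(if a 1 + a 2 \<le> n then c (multi_index n (a 1) (a 2)) else 0) = 0"
    by (metis coeff_dehom_poly coeff_0)
  then show ?thesis using assms(2) multi_index_eta[OF assms(2)]
    by (auto simp: mem_multi_indices split: if_splits)
qed

text \<open>In a fixed degree the exponent of \<open>x $ 3\<close> is determined by the other two,
  so the chart loses no coefficient.\<close>

lemma forms_dehom_eq:
  assumes "f \<in> forms n" "g \<in> forms n" "dehom f p" "dehom g p" shows "f = g"
proof -
  obtain c d where cd: "f = form n c" "g = form n d" using assms by (auto elim!: formsE)
  have eq: "dehom_poly n c = dehom_poly n d" using assms dehom_form dehom_unique by (metis cd)
  have "c a = d a" if "a \<in> multi_indices n" for a
  proof -
    have "coeff (coeff (dehom_poly n c) (a 2)) (a 1) = coeff (coeff (dehom_poly n d) (a 2)) (a 1)"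
      by (simp only: eq)
    moreover have "a 1 + a 2 \<le> n" using that by (simp add: mem_multi_indices)
    ultimately show ?thesis by (simp add: coeff_dehom_poly multi_index_eta[OF that, symmetric])
  qed
  then show ?thesis by (auto simp: cd form_def intro!: sum.cong)
qed

lemma forms_mult_eq_0:
  assumes "f \<in> forms m" "g \<in> forms n" "\<And>x. f x * g x = 0"
  shows "(\<forall>x. f x = 0) \<or> (\<forall>x. g x = 0)"
proof -
  obtain p q where pq: "dehom f p" "dehom g q" using assms(1,2) by (meson forms_dehomE)
  have "dehom (\<lambda>x. f x * g x) 0" using assms(3) by (simp add: dehom_def eval2_def)
  then have "p * q = 0" using pq dehom_mult dehom_unique by blast
  then consider "p = 0" | "q = 0" by auto
  then show ?thesis
  proof cases
    case 1
    then have "f = (\<lambda>x. 0)" using forms_dehom_eq[OF assms(1) forms_zero pq(1)] dehom_zero by simp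
    then show ?thesis by simp
  next
    case 2
    then have "g = (\<lambda>x. 0)" using forms_dehom_eq[OF assms(2) forms_zero pq(2)] dehom_zero by simp
    then show ?thesis by simp
  qed
qed

text \<open>Supplies a leading monomial: maximal total degree, ties broken by the exponent of
  \<open>y\<close>.\<close>

lemma total_degree_witness:
  assumes "p \<noteq> 0"
  obtains i j where "coeff (coeff p j) i \<noteq> 0" "tdeg_le (i + j) p"
    "\<And>i' j'. coeff (coeff p j') i' \<noteq> 0 \<Longrightarrow> i' + j' = i + j \<Longrightarrow> j' \<le> j"
proof -
  define S where "S = {(i, j). coeff (coeff p j) i \<noteq> 0}"
  have "S \<subseteq> (\<Union>j\<in>{..degree p}. {..degree (coeff p j)} \<times> {j})"
    unfolding S_def by (auto simp: le_degree) (metis coeff_0 le_degree)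
  then have fin: "finite S" by (rule finite_subset) auto
  have ne: "S \<noteq> {}"
    using assms unfolding S_def by (auto simp: poly_eq_iff)
  define m where "m = Max ((\<lambda>(i, j). i + j) ` S)"
  have mle: "i + j \<le> m" if "(i, j) \<in> S" for i j
    unfolding m_def using that fin by (intro Max_ge) force+
  have "m \<in> (\<lambda>(i, j). i + j) ` S"
    unfolding m_def using fin ne by (intro Max_in) auto
  then have ne': "{j. \<exists>i. (i, j) \<in> S \<and> i + j = m} \<noteq> {}" by auto
  have fin': "finite {j. \<exists>i. (i, j) \<in> S \<and> i + j = m}"
    by (rule finite_subset[of _ "snd ` S"]) (use fin in \<open>auto simp: image_iff\<close>, force)
  define j where "j = Max {j. \<exists>i. (i, j) \<in> S \<and> i + j = m}"
  have "j \<in> {j. \<exists>i. (i, j) \<in> S \<and> i + j = m}"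
    unfolding j_def using fin' ne' by (rule Max_in)
  then obtain i where i: "(i, j) \<in> S" "i + j = m" by auto
  show ?thesis
  proof
    show "coeff (coeff p j) i \<noteq> 0" using i by (simp add: S_def)
    show "tdeg_le (i + j) p"
      unfolding tdeg_le_def using mle i by (force simp: S_def)
    show "j' \<le> j" if "coeff (coeff p j') i' \<noteq> 0" "i' + j' = i + j" for i' j'
      unfolding j_def using fin' that i by (intro Max_ge) (auto simp: S_def)
  qed
qed

text \<open>Total degree is additive on products, so factors found in the chart homogenise to forms
  whose degrees add up to \<open>n\<close>. The last clause makes \<open>m\<close> the exact total
  degree of \<open>p\<close>; \<open>l\<close> may exceed that of \<open>q\<close> and absorbs the
  slack.\<close>

lemma tdeg_le_mult_split:
  assumes "p \<noteq> 0" "q \<noteq> 0" "tdeg_le n (p * q)"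
  obtains m l where "tdeg_le m p" "tdeg_le l q" "m + l = n"
    "\<And>k. tdeg_le k p \<Longrightarrow> m \<le> k"
proof -
  obtain i j where p: "coeff (coeff p j) i \<noteq> 0" "tdeg_le (i + j) p"
    "\<And>i' j'. coeff (coeff p j') i' \<noteq> 0 \<Longrightarrow> i' + j' = i + j \<Longrightarrow> j' \<le> j"
    by (rule total_degree_witness[OF assms(1)]) blast
  obtain i1 j1 where q: "coeff (coeff q j1) i1 \<noteq> 0" "tdeg_le (i1 + j1) q"
    "\<And>i' j'. coeff (coeff q j') i' \<noteq> 0 \<Longrightarrow> i' + j' = i1 + j1 \<Longrightarrow> j' \<le> j1"
    by (rule total_degree_witness[OF assms(2)]) blast
  txt \<open>The product of the leading monomials, by total degree and then by \<open>y\<close>-degree, does not cancel.\<close>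
  define h where "h = (\<lambda>j' i'. coeff (coeff p j') i' * coeff (coeff q (j + j1 - j')) (i + i1 - i'))"
  have h0: "j' = j \<and> i' = i" if "h j' i' \<noteq> 0" "j' \<le> j + j1" "i' \<le> i + i1" for i' j'
  proof -
    have nz: "coeff (coeff p j') i' \<noteq> 0" "coeff (coeff q (j + j1 - j')) (i + i1 - i') \<noteq> 0"
      using that(1) by (auto simp: h_def)
    have "i' + j' \<le> i + j" using nz(1) p(2) by (force simp: tdeg_le_def)
    moreover have "(i + i1 - i') + (j + j1 - j') \<le> i1 + j1" using nz(2) q(2) by (force simp: tdeg_le_def)
    ultimately have e: "i' + j' = i + j" "(i + i1 - i') + (j + j1 - j') = i1 + j1"
      using that by auto
    have "j' \<le> j" "j + j1 - j' \<le> j1" using p(3)[OF nz(1) e(1)] q(3)[OF nz(2) e(2)] .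
    then show ?thesis using e that by auto
  qed
  have h0': "h j' i' = 0" if "j' \<noteq> j \<or> i' \<noteq> i" "j' \<le> j + j1" "i' \<le> i + i1" for i' j'
    using h0[of j' i'] that by blast
  have "coeff (coeff (p * q) (j + j1)) (i + i1) = (\<Sum>j'\<le>j + j1. \<Sum>i'\<le>i + i1. h j' i')"
    by (simp add: coeff_mult coeff_sum h_def)
  also have "\<dots> = (\<Sum>j'\<le>j + j1. if j' = j then h j i else 0)"
  proof (intro sum.cong refl)
    fix j' assume j': "j' \<in> {..j + j1}"
    show "(\<Sum>i'\<le>i + i1. h j' i') = (if j' = j then h j i else 0)"
    proof (cases "j' = j")
      case True
      have "(\<Sum>i'\<le>i + i1. h j' i') = (\<Sum>i'\<le>i + i1. if i' = i then h j i else 0)"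
        using h0' j' True by (intro sum.cong) auto
      then show ?thesis using True by simp
    next
      case False
      then show ?thesis using h0' j' by (auto intro!: sum.neutral)
    qed
  qed
  also have "\<dots> = h j i" by simp
  also have "\<dots> \<noteq> 0" using p(1) q(1) by (simp add: h_def)
  finally have "(i + i1) + (j + j1) \<le> n"
    using assms(3) unfolding tdeg_le_def by (meson not_le)
  moreover have "tdeg_le (n - (i + j)) q"
    using q(2) calculation by (auto simp: tdeg_le_def)
  moreover have "i + j \<le> k" if "tdeg_le k p" for k
    using that p(1) by (auto simp: tdeg_le_def not_less[symmetric])
  ultimately show ?thesis using p(2) that[of "i + j" "n - (i + j)"] by auto
qed

section \<open>Linear systems\<close>

text \<open>Gaussian elimination: each equation is either trivial or can be solved for one unknown,
  which it removes from the others.\<close>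

lemma homogeneous_system_nontrivial:
  fixes M :: "'e \<Rightarrow> 'a \<Rightarrow> 'k::field"
  assumes "finite E" "finite A" "card E < card A"
  obtains x where "\<exists>a\<in>A. x a \<noteq> 0" "\<And>e. e \<in> E \<Longrightarrow> (\<Sum>a\<in>A. M e a * x a) = 0"
proof -
  have "\<exists>x. (\<exists>a\<in>A. x a \<noteq> 0) \<and> (\<forall>e\<in>E. (\<Sum>a\<in>A. M e a * x a) = 0)"
    using assms
  proof (induction E arbitrary: A M rule: finite_induct)
    case empty
    then have "A \<noteq> {}" by auto
    then show ?case by (auto intro!: exI[of _ "\<lambda>_. 1"])
  next
    case (insert e E)
    show ?case
    proof (cases "\<forall>a\<in>A. M e a = 0")
      case True
      have "card E < card A" using insert by simp
      from insert.IH[OF \<open>finite A\<close> this, of M] True show ?thesis by auto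
    next
      case False
      then obtain a0 where a0: "a0 \<in> A" "M e a0 \<noteq> 0" by auto
      have "card E < card (A - {a0})" using insert a0 by simp
      \<comment> \<open>The coefficients that remain after equation \<open>e\<close> has been solved
        for the unknown \<open>a0\<close> and substituted.\<close>
      from insert.IH[OF _ this, of "\<lambda>e' a. M e' a - M e' a0 * (M e a / M e a0)"] insert.prems
      obtain x where x: "\<exists>a\<in>A - {a0}. x a \<noteq> 0"
        "\<And>e'. e' \<in> E \<Longrightarrow> (\<Sum>a\<in>A - {a0}. (M e' a - M e' a0 * (M e a / M e a0)) * x a) = 0"
        by auto
      define r where "r = - (\<Sum>a\<in>A - {a0}. M e a * x a) / M e a0"
      define x' where "x' = x(a0 := r)"
      have split: "(\<Sum>a\<in>A. M e' a * x' a) = M e' a0 * r + (\<Sum>a\<in>A - {a0}. M e' a * x a)" for e'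
        using a0 insert.prems by (subst sum.remove[of _ a0]) (auto simp: x'_def)
      have "(\<Sum>a\<in>A. M e a * x' a) = 0"
        using a0 by (simp add: split r_def)
      moreover have "(\<Sum>a\<in>A. M e' a * x' a) = 0" if "e' \<in> E" for e'
      proof -
        have "(\<Sum>a\<in>A - {a0}. M e' a0 * (M e a / M e a0) * x a)
            = M e' a0 / M e a0 * (\<Sum>a\<in>A - {a0}. M e a * x a)"
          by (auto simp: sum_distrib_left intro!: sum.cong)
        then have "(\<Sum>a\<in>A - {a0}. M e' a0 * (M e a / M e a0) * x a) = - (M e' a0 * r)"
          by (simp add: r_def)
        then show ?thesis using x(2)[OF that]
          by (simp add: split left_diff_distrib sum_subtractf add.commute)
      qed
      moreover have "\<exists>a\<in>A. x' a \<noteq> 0" using x(1) by (auto simp: x'_def)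
      ultimately show ?thesis by blast
    qed
  qed
  then show ?thesis using that by blast
qed

text \<open>An injective linear map stays injective on a suitable choice of at most
  \<open>card B\<close> coordinates. In a minimal determining set \<open>S\<close>, each
  \<open>s\<close> has a vector \<open>c s\<close> that is killed by all other coordinates in
  \<open>S\<close> but not by \<open>s\<close>; such vectors are independent.\<close>

lemma determining_coordinates:
  fixes T :: "'a \<Rightarrow> 'b \<Rightarrow> 'k::field"
  assumes "finite A" "finite B"
    and inj: "\<And>c. (\<And>a. a \<in> A \<Longrightarrow> (\<Sum>b\<in>B. T a b * c b) = 0) \<Longrightarrow> \<forall>b\<in>B. c b = 0"
  obtains S where "S \<subseteq> A" "card S \<le> card B"
    "\<And>c. (\<And>a. a \<in> S \<Longrightarrow> (\<Sum>b\<in>B. T a b * c b) = 0) \<Longrightarrow> \<forall>b\<in>B. c b = 0"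
proof -
  define Q where "Q S \<longleftrightarrow> S \<subseteq> A \<and> (\<forall>c. (\<forall>a\<in>S. (\<Sum>b\<in>B. T a b * c b) = 0) \<longrightarrow> (\<forall>b\<in>B. c b = 0))" for S
  have "Q A" using inj by (auto simp: Q_def)
  then obtain S where S: "Q S" and min: "\<And>S'. Q S' \<Longrightarrow> card S \<le> card S'"
    using ex_has_least_nat[of Q A card] by blast
  have fin: "finite S" using S assms(1) finite_subset by (auto simp: Q_def)
  have "\<exists>c. (\<forall>a\<in>S - {s}. (\<Sum>b\<in>B. T a b * c b) = 0) \<and> (\<Sum>b\<in>B. T s b * c b) \<noteq> 0" if "s \<in> S" for s
  proof -
    have "\<not> Q (S - {s})" using min[of "S - {s}"] that fin
      by (metis card_Diff1_less not_le)
    then obtain c where c: "\<forall>a\<in>S - {s}. (\<Sum>b\<in>B. T a b * c b) = 0" "\<not> (\<forall>b\<in>B. c b = 0)"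
      using S by (auto simp: Q_def)
    then have "(\<Sum>b\<in>B. T s b * c b) \<noteq> 0"
      using S unfolding Q_def by (metis DiffI singletonD)
    then show ?thesis using c by blast
  qed
  then obtain c where c: "\<And>s a. s \<in> S \<Longrightarrow> a \<in> S \<Longrightarrow> a \<noteq> s \<Longrightarrow> (\<Sum>b\<in>B. T a b * c s b) = 0"
    "\<And>s. s \<in> S \<Longrightarrow> (\<Sum>b\<in>B. T s b * c s b) \<noteq> 0"
    by (metis DiffI singletonD)
  have "card S \<le> card B"
  proof (rule ccontr)
    assume "\<not> card S \<le> card B"
    then have "card B < card S" by simp
    \<comment> \<open>More than \<open>card B\<close> vectors \<open>c s\<close> are linearly
      dependent. Row \<open>s\<close> of \<open>T\<close> kills all of them except
      \<open>c s\<close>, so it isolates the coefficient \<open>x s\<close> of the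
      dependency.\<close>
    from homogeneous_system_nontrivial[OF assms(2) fin this, of "\<lambda>b s. c s b"]
    obtain x where x: "\<exists>s\<in>S. x s \<noteq> 0" "\<And>b. b \<in> B \<Longrightarrow> (\<Sum>s\<in>S. c s b * x s) = 0" by blast
    then obtain s where s: "s \<in> S" "x s \<noteq> 0" by blast
    have "0 = (\<Sum>b\<in>B. T s b * (\<Sum>s'\<in>S. c s' b * x s'))" using x(2) by simp
    also have "\<dots> = (\<Sum>b\<in>B. \<Sum>s'\<in>S. x s' * (T s b * c s' b))"
      by (simp add: sum_distrib_left mult_ac)
    also have "\<dots> = (\<Sum>s'\<in>S. x s' * (\<Sum>b\<in>B. T s b * c s' b))"
      by (subst sum.swap) (simp add: sum_distrib_left)
    also have "\<dots> = (\<Sum>s'\<in>S. if s' = s then x s * (\<Sum>b\<in>B. T s b * c s b) else 0)"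
      using c(1) s by (intro sum.cong) auto
    also have "\<dots> = x s * (\<Sum>b\<in>B. T s b * c s b)" using s fin by simp
    finally show False using s c(2) by simp
  qed
  then show ?thesis using S that by (auto simp: Q_def)
qed

section \<open>Vanishing order along lines\<close>

text \<open>For a polynomial \<open>f\<close>, this says that all Taylor terms at \<open>p\<close>
  of degree below \<open>N\<close> are zero. Divisibility along lines makes sums and products
  immediate.\<close>

definition vanish :: "nat \<Rightarrow> (real^3 \<Rightarrow> real) \<Rightarrow> real^3 \<Rightarrow> bool" where
  "vanish N f p \<longleftrightarrow> (\<forall>y. \<exists>r. \<forall>t. f (p + t *\<^sub>R y) = t ^ N * poly r t)"

definition mon_line :: "(3 \<Rightarrow> nat) \<Rightarrow> real^3 \<Rightarrow> real^3 \<Rightarrow> real poly" where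
  "mon_line a p y = (\<Prod>i\<in>UNIV. [:p $ i, y $ i:] ^ a i)"

definition form_line :: "nat \<Rightarrow> ((3 \<Rightarrow> nat) \<Rightarrow> real) \<Rightarrow> real^3 \<Rightarrow> real^3 \<Rightarrow> real poly" where
  "form_line n c p y = (\<Sum>a\<in>multi_indices n. smult (c a) (mon_line a p y))"

lemma poly_mon_line: "poly (mon_line a p y) t = mon a (p + t *\<^sub>R y)"
  by (simp add: mon_line_def mon_def poly_prod)

lemma poly_form_line: "poly (form_line n c p y) t = form n c (p + t *\<^sub>R y)"
  by (simp add: form_line_def form_def poly_sum poly_mon_line)

lemma degree_mon_line: "a \<in> multi_indices n \<Longrightarrow> degree (mon_line a p y) \<le> n"
proof -
  assume a: "a \<in> multi_indices n"
  have "degree (mon_line a p y) \<le> (\<Sum>i\<in>UNIV. degree ([:p $ i, y $ i:] ^ a i))"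
    unfolding mon_line_def by (rule degree_prod_sum_le[unfolded o_def]) simp
  also have "\<dots> \<le> (\<Sum>i\<in>UNIV. a i)"
    by (intro sum_mono order.trans[OF degree_power_le]) simp
  finally show ?thesis using a by (simp add: multi_indices_def)
qed

lemma degree_form_line: "degree (form_line n c p y) \<le> n"
  unfolding form_line_def
  by (intro degree_sum_le finite_multi_indices order.trans[OF degree_smult_le] degree_mon_line)

lemma coeff_mult_forms:
  assumes "\<And>j. (\<lambda>y. coeff (P y) j) \<in> forms j" "\<And>j. (\<lambda>y. coeff (Q y) j) \<in> forms j"
  shows "(\<lambda>y. coeff (P y * Q y) j) \<in> forms j"
  unfolding coeff_mult
proof (rule forms_sum)
  fix i assume "i \<in> {..j}"
  then show "(\<lambda>y. coeff (P y) i * coeff (Q y) (j - i)) \<in> forms j"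
    using forms_mult[OF assms(1)[of i] assms(2)[of "j - i"]] by simp
qed

lemma coeff_one_forms: "(\<lambda>y. coeff 1 j) \<in> forms j"
  by (cases j) (auto intro: forms_const forms_zero)

lemma coeff_power_forms:
  assumes "\<And>j. (\<lambda>y. coeff (P y) j) \<in> forms j"
  shows "(\<lambda>y. coeff (P y ^ k) j) \<in> forms j"
proof (induction k arbitrary: j)
  case 0 then show ?case using coeff_one_forms by simp
next
  case (Suc k) then show ?case using coeff_mult_forms[OF assms Suc] by simp
qed

lemma coeff_linear_forms: "(\<lambda>y. coeff [:p $ i, y $ i:] j) \<in> forms j"
proof -
  consider "j = 0" | "j = 1" | k where "j = Suc (Suc k)"
    by (metis One_nat_def not0_implies_Suc)
  then show ?thesis
    by cases (use forms_const forms_coord[of i] forms_zero in \<open>simp_all\<close>)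
qed

text \<open>The Taylor term of degree \<open>j\<close> at \<open>p\<close> is a form of degree
  \<open>j\<close> in the direction \<open>y\<close>, so its vanishing is one linear condition for
  each element of \<open>multi_indices j\<close>.\<close>

lemma coeff_mon_line_forms: "(\<lambda>y. coeff (mon_line a p y) j) \<in> forms j"
  unfolding mon_line_def UNIV_3
  by (simp del: One_nat_def)
    (intro coeff_mult_forms coeff_power_forms coeff_linear_forms)

lemma vanish_form_iff: "vanish N (form n c) p \<longleftrightarrow> (\<forall>y. \<forall>j<N. coeff (form_line n c p y) j = 0)"
proof -
  have "(\<exists>r. \<forall>t. form n c (p + t *\<^sub>R y) = t ^ N * poly r t) \<longleftrightarrow> monom 1 N dvd form_line n c p y" for y
  proof -
    have "(\<forall>t. form n c (p + t *\<^sub>R y) = t ^ N * poly r t) \<longleftrightarrow> form_line n c p y = monom 1 N * r" for r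
    proof -
      have "(\<forall>t. form n c (p + t *\<^sub>R y) = t ^ N * poly r t) \<longleftrightarrow> (\<forall>t. poly (form_line n c p y) t = poly (monom 1 N * r) t)"
        by (simp add: poly_form_line poly_monom)
      then show ?thesis by (metis poly_ext)
    qed
    then show ?thesis by (simp add: dvd_def)
  qed
  then show ?thesis by (simp add: vanish_def monom_1_dvd_iff')
qed

lemma vanish_mult: "vanish M f p \<Longrightarrow> vanish N g p \<Longrightarrow> vanish (M + N) (\<lambda>x. f x * g x) p"
  unfolding vanish_def
proof
  fix y assume "\<forall>y. \<exists>r. \<forall>t. f (p + t *\<^sub>R y) = t ^ M * poly r t"
    "\<forall>y. \<exists>r. \<forall>t. g (p + t *\<^sub>R y) = t ^ N * poly r t"
  then obtain r s where "\<forall>t. f (p + t *\<^sub>R y) = t ^ M * poly r t" "\<forall>t. g (p + t *\<^sub>R y) = t ^ N * poly s t"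
    by meson
  then show "\<exists>r. \<forall>t. f (p + t *\<^sub>R y) * g (p + t *\<^sub>R y) = t ^ (M + N) * poly r t"
    by (intro exI[of _ "r * s"]) (simp add: power_add)
qed

lemma vanish_add: "vanish N f p \<Longrightarrow> vanish N g p \<Longrightarrow> vanish N (\<lambda>x. f x + g x) p"
  unfolding vanish_def
proof
  fix y assume "\<forall>y. \<exists>r. \<forall>t. f (p + t *\<^sub>R y) = t ^ N * poly r t"
    "\<forall>y. \<exists>r. \<forall>t. g (p + t *\<^sub>R y) = t ^ N * poly r t"
  then obtain r s where "\<forall>t. f (p + t *\<^sub>R y) = t ^ N * poly r t" "\<forall>t. g (p + t *\<^sub>R y) = t ^ N * poly s t"
    by meson
  then show "\<exists>r. \<forall>t. f (p + t *\<^sub>R y) + g (p + t *\<^sub>R y) = t ^ N * poly r t"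
    by (intro exI[of _ "r + s"]) (simp add: distrib_left)
qed

lemma vanish_zero: "vanish N (\<lambda>x. 0) p"
  unfolding vanish_def by (auto intro!: exI[of _ 0])

lemma vanish_sum: "(\<And>i. i \<in> I \<Longrightarrow> vanish N (f i) p) \<Longrightarrow> vanish N (\<lambda>x. \<Sum>i\<in>I. f i x) p"
  by (induction I rule: infinite_finite_induct) (auto intro: vanish_add vanish_zero)

lemma vanish_0: "f \<in> forms n \<Longrightarrow> vanish 0 f p"
  by (auto elim!: formsE simp: vanish_form_iff)

lemma vanish_power: "f \<in> forms m \<Longrightarrow> f p = 0 \<Longrightarrow> vanish k (\<lambda>x. f x ^ k) p"
proof -
  assume f: "f \<in> forms m" "f p = 0"
  then obtain c where c: "f = form m c" by (auto elim: formsE)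
  have 1: "vanish 1 f p"
    using f poly_form_line[of m c p _ 0] by (auto simp: c vanish_form_iff poly_0_coeff_0)
  show ?thesis
  proof (induction k)
    case 0 then show ?case using vanish_0[OF forms_const[of 1], of p] by simp
  next
    case (Suc k) then show ?case using vanish_mult[OF 1 Suc] by simp
  qed
qed

text \<open>Along each line through \<open>p\<close> the factor \<open>e\<close> has order 0 at
  \<open>t = 0\<close>, so by additivity of the order the whole power of \<open>t\<close> divides
  \<open>g\<close>.\<close>

lemma vanish_cancel:
  assumes "e \<in> forms m" "g \<in> forms n" "e p \<noteq> 0" "vanish N (\<lambda>x. e x * g x) p"
  shows "vanish N g p"
  unfolding vanish_def
proof
  fix y
  obtain c d where cd: "e = form m c" "g = form n d" using assms(1,2) by (auto elim!: formsE)
  define E where "E = form_line m c p y"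
  define G where "G = form_line n d p y"
  obtain r where r: "\<And>t. e (p + t *\<^sub>R y) * g (p + t *\<^sub>R y) = t ^ N * poly r t"
    using assms(4) unfolding vanish_def by meson
  have "E * G = [:0, 1:] ^ N * r"
    by (rule poly_ext) (simp add: r[symmetric] E_def G_def poly_form_line cd)
  then have dvd: "[:-0, 1:] ^ N dvd E * G" by simp
  have E0: "poly E 0 \<noteq> 0" using assms(3) by (simp add: E_def poly_form_line cd)
  have "[:-0, 1:] ^ N dvd G"
  proof (cases "G = 0")
    case False
    then have "E * G \<noteq> 0" using E0 by auto
    then have "N \<le> order 0 E + order 0 G" using dvd order_divides order_mult by metis
    moreover have "order 0 E = 0" using E0 by (simp add: order_0I)
    ultimately show ?thesis using order_divides by (metis add_0)
  qed auto
  then obtain s where "G = [:0, 1:] ^ N * s" by (auto elim: dvdE)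
  then have "poly G t = t ^ N * poly s t" for t by simp
  then show "\<exists>r. \<forall>t. g (p + t *\<^sub>R y) = t ^ N * poly r t"
    by (auto simp: G_def poly_form_line cd)
qed

text \<open>On the line from \<open>p\<close> to \<open>x\<close> a polynomial of degree at most
  \<open>n\<close> is divisible by the power \<open>n + 1\<close> of \<open>t\<close>.\<close>

lemma vanish_above_degree:
  assumes "f \<in> forms n" "vanish (Suc n) f p" shows "f x = 0"
proof -
  obtain c where c: "f = form n c" using assms(1) by (auto elim: formsE)
  have "coeff (form_line n c p (x - p)) j = 0" for j
    using assms(2) degree_form_line[of n c p "x - p"]
    by (cases "j < Suc n") (auto simp: c vanish_form_iff coeff_eq_0)
  then have "form_line n c p (x - p) = 0" by (simp add: poly_eq_iff)
  then show ?thesis using poly_form_line[of n c p "x - p" 1] by (simp add: c)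
qed

text \<open>By homogeneity: \<open>p + t (y + s p) = (1 + s t) (p + t / (1 + s t) y)\<close>.\<close>

lemma form_line_shift:
  "form_line n c p (y + s *\<^sub>R p)
     = (\<Sum>j\<le>n. smult (coeff (form_line n c p y) j) (monom 1 j * [:1, s:] ^ (n - j)))" (is "?L = ?R")
proof -
  \<comment> \<open>The homogeneity argument needs \<open>1 + s * t\<close> to be nonzero. The extra
    factor \<open>[:1, s:]\<close> makes both sides zero at the exceptional \<open>t\<close> and is
    cancelled at the end.\<close>
  have "poly ([:1, s:] * ?L) t = poly ([:1, s:] * ?R) t" for t
  proof (cases "1 + s * t = 0")
    case False
    define a where "a = 1 + s * t"
    have a: "a \<noteq> 0" using False by (simp add: a_def)
    have "p + t *\<^sub>R (y + s *\<^sub>R p) = a *\<^sub>R (p + (t / a) *\<^sub>R y)"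
    proof -
      have "a *\<^sub>R (p + (t / a) *\<^sub>R y) = a *\<^sub>R p + t *\<^sub>R y"
        using a by (simp add: scaleR_add_right)
      also have "a *\<^sub>R p = p + t *\<^sub>R s *\<^sub>R p"
        by (simp add: a_def scaleR_add_left mult.commute)
      finally show ?thesis by (simp add: scaleR_add_right add_ac)
    qed
    then have "poly ?L t = a ^ n * poly (form_line n c p y) (t / a)"
      by (simp add: poly_form_line forms_homogeneous[OF form_in_forms])
    also have "poly (form_line n c p y) (t / a) = (\<Sum>j\<le>n. coeff (form_line n c p y) j * (t / a) ^ j)"
      by (simp add: poly_altdef) (rule sum.mono_neutral_left, use degree_form_line in \<open>auto simp: coeff_eq_0\<close>)
    also have "a ^ n * \<dots> = (\<Sum>j\<le>n. coeff (form_line n c p y) j * (t ^ j * a ^ (n - j)))"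
      using a by (auto simp: sum_distrib_left power_divide power_diff intro!: sum.cong)
    also have "\<dots> = poly ?R t"
      by (simp add: poly_sum poly_monom a_def mult_ac)
    finally show ?thesis by simp
  next
    case True
    then have "poly [:1, s:] t = 0" by (simp add: mult.commute)
    then show ?thesis by (simp only: poly_mult mult_zero_left)
  qed
  then have "[:1, s:] * ?L = [:1, s:] * ?R" by (rule poly_ext)
  then show ?thesis by (subst (asm) mult_left_cancel) auto
qed

text \<open>The \<open>N\<close>-th coefficient along \<open>y + s p\<close>, as a polynomial in \<open>s\<close>, contains all lower
  coefficients along \<open>y\<close>. Hence vanishing to order \<open>N + 1\<close> costs only as many conditions as there
  are forms of degree \<open>N\<close>.\<close>

lemma vanish_of_top_coeff:
  assumes "N \<le> n" "\<And>y. coeff (form_line n c p y) N = 0"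
  shows "vanish (Suc N) (form n c) p"
  unfolding vanish_form_iff
proof (intro allI impI)
  fix y j assume j: "j < Suc N"
  \<comment> \<open>The coefficient of the power \<open>N - j\<close> of \<open>s\<close> in the
    \<open>N\<close>-th coefficient along \<open>y + s p\<close>, by the binomial theorem. The
    binomial coefficient is nonzero since \<open>N \<le> n\<close>.\<close>
  define g where "g j = coeff (form_line n c p y) j * of_nat ((n - j) choose (N - j))" for j
  have "poly (\<Sum>j\<le>N. monom (g j) (N - j)) s = 0" for s
  proof -
    have "0 = coeff (form_line n c p (y + s *\<^sub>R p)) N" using assms(2) by simp
    also have "\<dots> = (\<Sum>j\<le>n. coeff (form_line n c p y) j * (if N < j then 0 else coeff ([:1, s:] ^ (n - j)) (N - j)))"
      unfolding form_line_shift by (auto simp: coeff_sum coeff_monom_mult intro!: sum.cong)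
    also have "\<dots> = (\<Sum>j\<le>N. coeff (form_line n c p y) j * coeff ([:1, s:] ^ (n - j)) (N - j))"
      using assms(1) by (intro sum.mono_neutral_cong_right) auto
    also have "\<dots> = poly (\<Sum>j\<le>N. monom (g j) (N - j)) s"
      using assms(1) by (auto simp: poly_sum poly_monom g_def coeff_linear_poly_power intro!: sum.cong)
    finally show ?thesis by simp
  qed
  then have "(\<Sum>j\<le>N. monom (g j) (N - j)) = 0" by (intro poly_ext) simp
  then have "0 = coeff (\<Sum>j\<le>N. monom (g j) (N - j)) (N - j)" by simp
  also have "\<dots> = (\<Sum>i\<le>N. if i = j then g j else 0)"
    unfolding coeff_sum using j by (intro sum.cong) auto
  also have "\<dots> = g j" using j by simp
  finally show "coeff (form_line n c p y) j = 0"
    using j assms(1) by (auto simp: g_def)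
qed

text \<open>The conditions are the coefficients of the Taylor term of degree \<open>N\<close>, as a
  form in the direction; this top term alone suffices by \<open>vanish_of_top_coeff\<close>.\<close>

lemma vanish_conditions:
  assumes "N \<le> n"
  obtains K where "\<And>c. (\<And>b. b \<in> multi_indices N \<Longrightarrow> (\<Sum>a\<in>multi_indices n. K b a * c a) = 0)
    \<Longrightarrow> vanish (Suc N) (form n c) p"
proof -
  have "\<exists>k. (\<lambda>y. coeff (mon_line a p y) N) = form N k" for a
    by (metis coeff_mon_line_forms formsE)
  then obtain K where K: "\<And>a. (\<lambda>y. coeff (mon_line a p y) N) = form N (K a)" by metis
  show ?thesis
  proof (rule that[of "\<lambda>b a. K a b"])
    fix c assume c: "\<And>b. b \<in> multi_indices N \<Longrightarrow> (\<Sum>a\<in>multi_indices n. K a b * c a) = 0"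
    have "coeff (form_line n c p y) N = 0" for y
    proof -
      have "coeff (form_line n c p y) N = (\<Sum>a\<in>multi_indices n. c a * form N (K a) y)"
        unfolding form_line_def coeff_sum using fun_cong[OF K] by simp
      also have "\<dots> = (\<Sum>b\<in>multi_indices N. (\<Sum>a\<in>multi_indices n. K a b * c a) * mon b y)"
        unfolding form_def sum_distrib_left sum_distrib_right
        by (subst sum.swap) (simp add: mult_ac)
      also have "\<dots> = 0" using c by simp
      finally show ?thesis .
    qed
    then show "vanish (Suc N) (form n c) p" using assms by (rule vanish_of_top_coeff[rotated])
  qed
qed

section \<open>Bezout's inequality for ternary forms\<close>

lemma card_multi_indices: "2 * card (multi_indices n) = (n + 1) * (n + 2)"
proof -
  have "bij_betw (\<lambda>(s, i). multi_index n i (s - i)) (SIGMA s:{..n}. {..s}) (multi_indices n)"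
    by (rule bij_betw_byWitness[of _ "\<lambda>a. (a 1 + a 2, a 1)"])
      (auto simp: mem_multi_indices multi_index_eta[symmetric])
  then have "card (multi_indices n) = (\<Sum>s\<le>n. s + 1)"
    by (subst bij_betw_same_card[symmetric]) auto
  also have "2 * \<dots> = (n + 1) * (n + 2)" by (induction n) auto
  finally show ?thesis by simp
qed

lemma form_coeff_unique:
  assumes "\<And>x. form n c x = form n d x" "a \<in> multi_indices n"
  shows "c a = d a"
proof -
  have "form n (\<lambda>a. c a - d a) x = 0" for x
    using assms(1)[of x] by (simp add: form_def left_diff_distrib sum_subtractf)
  from form_zero_coeff[OF this assms(2)] show ?thesis by simp
qed

lemma inner_sq_unit_ne_1:
  fixes p q :: "'a::real_inner"
  assumes "norm p = 1" "norm q = 1" "p \<noteq> q" "p \<noteq> - q"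
  shows "(p \<bullet> q) ^ 2 \<noteq> 1"
proof
  assume "(p \<bullet> q) ^ 2 = 1"
  then have "p \<bullet> q = 1 \<or> p \<bullet> q = -1" by (simp add: power2_eq_1_iff)
  moreover have "(norm (p - q))\<^sup>2 = 2 - 2 * (p \<bullet> q)" "(norm (p + q))\<^sup>2 = 2 + 2 * (p \<bullet> q)"
    using assms(1,2) by (simp_all add: power2_norm_eq_inner norm_eq_1 inner_commute algebra_simps)
  ultimately have "(norm (p - q))\<^sup>2 = 0 \<or> (norm (p + q))\<^sup>2 = 0" by auto
  then show False using assms(3,4) by (auto simp: eq_neg_iff_add_eq_0)
qed

text \<open>The inner product with the component of \<open>p\<close> orthogonal to \<open>q\<close>
  is a linear form that vanishes at \<open>q\<close> but not at \<open>p\<close>, as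
  \<open>p\<close> is neither \<open>q\<close> nor \<open>- q\<close>. Powers of these are
  multiplied; the power of \<open>x \<bullet> p\<close> only adjusts the degree.\<close>

lemma separating_form:
  fixes T :: "(real^3) set"
  assumes "finite T" "\<And>q. q \<in> T \<Longrightarrow> norm q = 1" "\<And>q. q \<in> T \<Longrightarrow> - q \<notin> T" "p \<in> T"
  obtains e where "e \<in> forms ((\<Sum>q\<in>T - {p}. N q) + r)" "e p \<noteq> 0"
    "\<And>q. q \<in> T - {p} \<Longrightarrow> vanish (N q) e q"
proof -
  define h where "h q = (\<lambda>x. x \<bullet> (p - (p \<bullet> q) *\<^sub>R q))" for q
  have h: "h q \<in> forms 1" for q unfolding h_def by (rule forms_inner)
  define e where "e = (\<lambda>x. (\<Prod>q\<in>T - {p}. h q x ^ N q) * (x \<bullet> p) ^ r)"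
  show ?thesis
  proof
    have pow: "(\<lambda>x. (x \<bullet> p) ^ r) \<in> forms (1 * r)"
      by (intro forms_power forms_inner)
    have "(\<lambda>x. (\<Prod>q\<in>T - {p}. h q x ^ N q)) \<in> forms (\<Sum>q\<in>T - {p}. 1 * N q)"
      using assms(1) by (intro forms_prod forms_power h) auto
    from forms_mult[OF this pow] show "e \<in> forms ((\<Sum>q\<in>T - {p}. N q) + r)"
      unfolding e_def by simp
    have "h q p \<noteq> 0" if "q \<in> T - {p}" for q
    proof -
      have "p \<noteq> - q" using that assms(3)[of q] assms(4) by auto
      then have "(p \<bullet> q)^2 \<noteq> 1" using that assms by (intro inner_sq_unit_ne_1) auto
      then show ?thesis
        using assms(2)[OF assms(4)] by (simp add: h_def inner_diff_right norm_eq_1 power2_eq_square inner_commute)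
    qed
    then show "e p \<noteq> 0"
      using assms by (auto simp: e_def norm_eq_1)
    fix q assume q: "q \<in> T - {p}"
    have split: "e = (\<lambda>x. h q x ^ N q * ((\<Prod>q\<in>T - {p} - {q}. h q x ^ N q) * (x \<bullet> p) ^ r))"
      unfolding e_def using assms(1) q by (subst prod.remove[of _ q]) (auto simp: mult_ac)
    have "vanish (N q) (\<lambda>x. h q x ^ N q) q"
      using q assms(2) by (intro vanish_power[OF h]) (auto simp: h_def inner_diff_right norm_eq_1 inner_commute)
    moreover have "(\<lambda>x. (\<Prod>q\<in>T - {p} - {q}. h q x ^ N q)) \<in> forms (\<Sum>q\<in>T - {p} - {q}. 1 * N q)"
      using assms(1) by (intro forms_prod forms_power h) auto
    then have "vanish 0 (\<lambda>x. (\<Prod>q\<in>T - {p} - {q}. h q x ^ N q) * (x \<bullet> p) ^ r) q"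
      by (rule vanish_0[OF forms_mult[OF _ pow]])
    ultimately show "vanish (N q) e q"
      unfolding split using vanish_mult by fastforce
  qed
qed

lemma product_coefficients:
  assumes "f \<in> forms m"
  obtains C where "\<And>c. (\<lambda>x. f x * form n c x) = form (m + n) (\<lambda>b. \<Sum>a\<in>multi_indices n. C a b * c a)"
proof -
  have "\<exists>k. (\<lambda>x. f x * mon a x) = form (m + n) k" if "a \<in> multi_indices n" for a
    using forms_mult[OF assms mon_in_forms[OF that]] by (metis formsE)
  then obtain C where C: "\<And>a. a \<in> multi_indices n \<Longrightarrow> (\<lambda>x. f x * mon a x) = form (m + n) (C a)"
    by metis
  show ?thesis
  proof (rule that, rule ext)
    fix c x
    have "f x * form n c x = (\<Sum>a\<in>multi_indices n. c a * (f x * mon a x))"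
      by (simp add: form_def sum_distrib_left mult_ac)
    also have "\<dots> = (\<Sum>a\<in>multi_indices n. c a * form (m + n) (C a) x)"
      using fun_cong[OF C] by (intro sum.cong) auto
    also have "\<dots> = form (m + n) (\<lambda>b. \<Sum>a\<in>multi_indices n. C a b * c a) x"
      unfolding form_def sum_distrib_left sum_distrib_right
      by (subst sum.swap) (simp add: mult_ac)
    finally show "f x * form n c x = \<dots>" .
  qed
qed

text \<open>Multiplication by \<open>v\<close> is injective, so few coefficients detect whether a
  multiple of \<open>v\<close> is zero. Requiring them to vanish excludes the trivial syzygies at
  the cost of at most the dimension of the forms of degree \<open>m\<close>.\<close>

lemma multiple_determining_coordinates:
  assumes v: "v \<in> forms n" and nz: "v z \<noteq> 0"
  obtains S where "S \<subseteq> multi_indices (n + m)" "card S \<le> card (multi_indices m)"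
    "\<And>c d. c \<in> forms m \<Longrightarrow> (\<And>x. form (n + m) d x = v x * c x) \<Longrightarrow> (\<And>a. a \<in> S \<Longrightarrow> d a = 0)
      \<Longrightarrow> (\<forall>x. c x = 0)"
proof -
  obtain C where C: "\<And>c. (\<lambda>x. v x * form m c x) = form (n + m) (\<lambda>b. \<Sum>a\<in>multi_indices m. C a b * c a)"
    by (rule product_coefficients[OF v, of m]) blast
  have "\<forall>b\<in>multi_indices m. c b = 0"
    if "\<And>a. a \<in> multi_indices (n + m) \<Longrightarrow> (\<Sum>b\<in>multi_indices m. C b a * c b) = 0" for c
  proof -
    have "v x * form m c x = 0" for x
      using that fun_cong[OF C[of c], of x] by (simp add: form_def)
    then have "(\<forall>x. v x = 0) \<or> (\<forall>x. form m c x = 0)"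
      by (rule forms_mult_eq_0[OF v form_in_forms])
    then show ?thesis using nz form_zero_coeff by blast
  qed
  note inj = this
  obtain S where S: "S \<subseteq> multi_indices (n + m)" "card S \<le> card (multi_indices m)"
    "\<And>c. (\<And>a. a \<in> S \<Longrightarrow> (\<Sum>b\<in>multi_indices m. C b a * c b) = 0) \<Longrightarrow> \<forall>b\<in>multi_indices m. c b = 0"
    by (rule determining_coordinates[of "multi_indices (n + m)" "multi_indices m" "\<lambda>a b. C b a",
        OF finite_multi_indices finite_multi_indices inj]) blast+
  show ?thesis
  proof (rule that[OF S(1,2)])
    fix c d assume c: "c \<in> forms m" and d: "\<And>x. form (n + m) d x = v x * c x" "\<And>a. a \<in> S \<Longrightarrow> d a = 0"
    obtain c' where c': "c = form m c'" using c by (rule formsE)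
    have "form (n + m) (\<lambda>a. \<Sum>b\<in>multi_indices m. C b a * c' b) x = form (n + m) d x" for x
      using fun_cong[OF C[of c'], of x] d(1)[of x] by (simp add: c')
    then have "(\<Sum>b\<in>multi_indices m. C b a * c' b) = d a" if "a \<in> multi_indices (n + m)" for a
      using form_coeff_unique[of "n + m" "\<lambda>a. \<Sum>b\<in>multi_indices m. C b a * c' b" d a] that by blast
    then have "\<forall>b\<in>multi_indices m. c' b = 0" by (intro S(3)) (use S(1) d(2) in auto)
    then show "\<forall>x. c x = 0" by (simp add: c' form_def)
  qed
qed

text \<open>Assumption \<open>syz\<close> is the coprimality of \<open>u\<close> and
  \<open>v\<close> in the form in which the dimension count uses it; \<open>anti\<close> makes the
  points of \<open>T\<close> projectively distinct.\<close>

lemma bezout_forms_pos: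
  fixes T :: "(real^3) set"
  assumes fin: "finite T" and unit: "\<And>p. p \<in> T \<Longrightarrow> norm p = 1" and anti: "\<And>p. p \<in> T \<Longrightarrow> - p \<notin> T"
    and u: "u \<in> forms n" and v: "v \<in> forms n" and nz: "v z \<noteq> 0"
    and k: "\<And>p. p \<in> T \<Longrightarrow> vanish (k p) u p" and l: "\<And>p. p \<in> T \<Longrightarrow> vanish (l p) v p"
    and k0: "\<And>p. p \<in> T \<Longrightarrow> 0 < k p" and l0: "\<And>p. p \<in> T \<Longrightarrow> 0 < l p"
    and syz: "\<And>m a b. a \<in> forms (n + m) \<Longrightarrow> b \<in> forms (n + m) \<Longrightarrow> (\<And>x. u x * a x + v x * b x = 0)
      \<Longrightarrow> \<exists>c\<in>forms m. \<forall>x. a x = v x * c x \<and> b x = - (u x * c x)"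
  shows "(\<Sum>p\<in>T. k p * l p) \<le> n\<^sup>2"
proof -
  define N where "N p = k p + l p" for p
  \<comment> \<open>\<open>M\<close> will be the degree of the factor \<open>c\<close> in a syzygy,
    \<open>D\<close> that of \<open>a\<close> and \<open>b\<close>, and \<open>d = 2 * n + M\<close>
    that of the whole relation. \<open>M\<close> leaves room for the separating forms
    \<open>e p\<close>.\<close>
  define M where "M = (\<Sum>p\<in>T. N p)"
  define D where "D = n + M"
  define d where "d = n + D"
  have NM: "N p \<le> M" if "p \<in> T" for p
    unfolding M_def using that fin by (intro member_le_sum) auto
  have MN: "(\<Sum>q\<in>T - {p}. N q) = M - N p" if "p \<in> T" for p
    unfolding M_def using that fin by (simp add: sum_diff1_nat)
  have N0: "Suc (N p - 1) = N p" "Suc (k p - 1) = k p" "Suc (l p - 1) = l p" if "p \<in> T" for p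
    using k0[OF that] by (auto simp: N_def k0[OF that] l0[OF that])
  \<comment> \<open>The padding \<open>2 * n + 1\<close> is chosen so that \<open>e p\<close> times
    a form of degree \<open>N p - 1\<close> has degree exactly \<open>d\<close>.\<close>
  have "\<exists>e. e \<in> forms ((\<Sum>q\<in>T - {p}. N q) + (2 * n + 1)) \<and> e p \<noteq> 0 \<and> (\<forall>q\<in>T - {p}. vanish (N q) e q)"
    if "p \<in> T" for p
    by (rule separating_form[OF fin unit anti that, of N "2 * n + 1"], assumption, assumption,
      intro exI conjI ballI, assumption, assumption, blast)
  then obtain e where e: "\<And>p. p \<in> T \<Longrightarrow> e p \<in> forms ((\<Sum>q\<in>T - {p}. N q) + (2 * n + 1))"
    "\<And>p. p \<in> T \<Longrightarrow> e p p \<noteq> 0" "\<And>p q. p \<in> T \<Longrightarrow> q \<in> T \<Longrightarrow> q \<noteq> p \<Longrightarrow> vanish (N q) (e p) q"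
    by (metis DiffI singletonD)
  have deg: "(\<Sum>q\<in>T - {p}. N q) + (2 * n + 1) + (N p - 1) = d" if "p \<in> T" for p
    using NM[OF that] N0[OF that] by (simp add: MN[OF that] d_def D_def)

  obtain Cu where Cu: "\<And>c. (\<lambda>x. u x * form D c x) = form d (\<lambda>b. \<Sum>a\<in>multi_indices D. Cu a b * c a)"
    unfolding d_def by (rule product_coefficients[OF u, of D]) blast
  obtain Cv where Cv: "\<And>c. (\<lambda>x. v x * form D c x) = form d (\<lambda>b. \<Sum>a\<in>multi_indices D. Cv a b * c a)"
    unfolding d_def by (rule product_coefficients[OF v, of D]) blast
  have "\<forall>p\<in>T. \<exists>C. \<forall>c. (\<lambda>x. e p x * form (N p - 1) c x) = form d (\<lambda>b. \<Sum>a\<in>multi_indices (N p - 1). C a b * c a)"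
  proof
    fix p assume p: "p \<in> T"
    show "\<exists>C. \<forall>c. (\<lambda>x. e p x * form (N p - 1) c x) = form d (\<lambda>b. \<Sum>a\<in>multi_indices (N p - 1). C a b * c a)"
      by (rule product_coefficients[OF e(1)[OF p], of "N p - 1", unfolded deg[OF p]]) blast
  qed
  from bchoice[OF this] obtain Ce where Ce: "\<And>p c. p \<in> T \<Longrightarrow>
    (\<lambda>x. e p x * form (N p - 1) c x) = form d (\<lambda>b. \<Sum>a\<in>multi_indices (N p - 1). Ce p a b * c a)"
    by blast
  have "\<forall>p\<in>T. \<exists>K. \<forall>c. (\<forall>b\<in>multi_indices (l p - 1). (\<Sum>a\<in>multi_indices D. K b a * c a) = 0)
    \<longrightarrow> vanish (l p) (form D c) p"
  proof
    fix p assume that: "p \<in> T"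
    have "l p - 1 \<le> D" using NM[OF that] by (simp add: N_def D_def)
    then show "\<exists>K. \<forall>c. (\<forall>b\<in>multi_indices (l p - 1). (\<Sum>a\<in>multi_indices D. K b a * c a) = 0)
    \<longrightarrow> vanish (l p) (form D c) p"
      by (rule vanish_conditions[of "l p - 1" D p, unfolded N0[OF that]]) blast
  qed
  from bchoice[OF this] obtain Ka where Ka: "\<And>p c. p \<in> T \<Longrightarrow>
    (\<And>b. b \<in> multi_indices (l p - 1) \<Longrightarrow> (\<Sum>a\<in>multi_indices D. Ka p b a * c a) = 0)
    \<Longrightarrow> vanish (l p) (form D c) p" by blast
  have "\<forall>p\<in>T. \<exists>K. \<forall>c. (\<forall>b\<in>multi_indices (k p - 1). (\<Sum>a\<in>multi_indices D. K b a * c a) = 0)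
    \<longrightarrow> vanish (k p) (form D c) p"
  proof
    fix p assume that: "p \<in> T"
    have "k p - 1 \<le> D" using NM[OF that] by (simp add: N_def D_def)
    then show "\<exists>K. \<forall>c. (\<forall>b\<in>multi_indices (k p - 1). (\<Sum>a\<in>multi_indices D. K b a * c a) = 0)
    \<longrightarrow> vanish (k p) (form D c) p"
      by (rule vanish_conditions[of "k p - 1" D p, unfolded N0[OF that]]) blast
  qed
  from bchoice[OF this] obtain Kb where Kb: "\<And>p c. p \<in> T \<Longrightarrow>
    (\<And>b. b \<in> multi_indices (k p - 1) \<Longrightarrow> (\<Sum>a\<in>multi_indices D. Kb p b a * c a) = 0)
    \<Longrightarrow> vanish (k p) (form D c) p" by blast
  obtain S where S: "S \<subseteq> multi_indices D" "card S \<le> card (multi_indices M)"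
    "\<And>c d. c \<in> forms M \<Longrightarrow> (\<And>x. form D d x = v x * c x) \<Longrightarrow> (\<And>a. a \<in> S \<Longrightarrow> d a = 0)
      \<Longrightarrow> (\<forall>x. c x = 0)"
    unfolding D_def by (rule multiple_determining_coordinates[OF v nz, of M]) blast
  have finS: "finite S" using S(1) finite_multi_indices finite_subset by blast

  txt \<open>The unknowns \<open>A\<close> are the coefficients of \<open>a\<close>, \<open>b\<close> and of the forms \<open>g p\<close> in
    \<open>u a + v b + (\<Sum>p\<in>T. e p * g p) = 0\<close>. The equations \<open>E\<close> are this one, the vanishing of \<open>a\<close>
    and \<open>b\<close>, and \<open>card S\<close> further ones that exclude the syzygies \<open>(v c, - u c)\<close>.\<close>
  define A where "A = multi_indices D <+> (multi_indices D <+> (SIGMA p:T. multi_indices (N p - 1)))"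
  define E where "E = multi_indices d <+> ((SIGMA p:T. multi_indices (l p - 1)) <+>
    ((SIGMA p:T. multi_indices (k p - 1)) <+> S))"
  \<comment> \<open>\<open>R i j\<close> is the coefficient of the unknown \<open>j\<close> in the
    equation \<open>i\<close>, with the summands in the order of \<open>E\<close> and
    \<open>A\<close>.\<close>
  define R where "R = case_sum (\<lambda>b. case_sum (\<lambda>a. Cu a b) (case_sum (\<lambda>a. Cv a b) (\<lambda>(p, a). Ce p a b)))
    (case_sum (\<lambda>(p, b). case_sum (\<lambda>a. Ka p b a) (\<lambda>_. 0))
      (case_sum (\<lambda>(p, b). case_sum (\<lambda>_. 0) (case_sum (\<lambda>a. Kb p b a) (\<lambda>_. 0)))
        (\<lambda>s. case_sum (\<lambda>a. if a = s then 1 else 0) (\<lambda>_. 0))))"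
  have finA: "finite A" and finE: "finite E"
    unfolding A_def E_def using fin finS by (auto intro!: finite_multi_indices finite_Plus)

  have "card A \<le> card E"
  proof (rule ccontr)
    \<comment> \<open>With more unknowns than equations there is a nonzero solution; it is shown
      that every solution is zero.\<close>
    assume "\<not> card A \<le> card E"
    then have "card E < card A" by simp
    from homogeneous_system_nontrivial[OF finE finA this, of R]
    obtain x where x: "\<exists>i\<in>A. x i \<noteq> 0" "\<And>i. i \<in> E \<Longrightarrow> (\<Sum>j\<in>A. R i j * x j) = 0" by blast
    define ca where "ca a = x (Inl a)" for a
    define cb where "cb a = x (Inr (Inl a))" for a
    define cg where "cg p a = x (Inr (Inr (p, a)))" for p a
    have sumA: "(\<Sum>j\<in>A. h j) = (\<Sum>a\<in>multi_indices D. h (Inl a)) + (\<Sum>a\<in>multi_indices D. h (Inr (Inl a)))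
        + (\<Sum>p\<in>T. \<Sum>a\<in>multi_indices (N p - 1). h (Inr (Inr (p, a))))" for h :: "_ \<Rightarrow> real"
      unfolding A_def using fin
      by (simp add: sum.Plus finite_multi_indices sum.Sigma o_def split_def)
    define a where "a = form D ca"
    define b where "b = form D cb"
    define g where "g p = form (N p - 1) (cg p)" for p
    have rel: "u y * a y + v y * b y + (\<Sum>p\<in>T. e p y * g p y) = 0" for y
    proof -
      have eg: "(\<Sum>p\<in>T. e p y * g p y)
          = (\<Sum>p\<in>T. form d (\<lambda>b. \<Sum>a\<in>multi_indices (N p - 1). Ce p a b * cg p a) y)"
        by (intro sum.cong refl) (simp only: g_def fun_cong[OF Ce])
      have "u y * a y + v y * b y + (\<Sum>p\<in>T. e p y * g p y)
          = form d (\<lambda>b. \<Sum>a\<in>multi_indices D. Cu a b * ca a) y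
          + form d (\<lambda>b. \<Sum>a\<in>multi_indices D. Cv a b * cb a) y
          + (\<Sum>p\<in>T. form d (\<lambda>b. \<Sum>a\<in>multi_indices (N p - 1). Ce p a b * cg p a) y)"
        unfolding eg a_def b_def fun_cong[OF Cu[of ca], of y] fun_cong[OF Cv[of cb], of y] ..
      also have "\<dots> = (\<Sum>i\<in>multi_indices d. (\<Sum>j\<in>A. R (Inl i) j * x j) * mon i y)"
        unfolding form_def
        by (subst sum.swap) (simp add: sumA R_def ca_def cb_def cg_def distrib_right sum.distrib sum_distrib_right)
      also have "\<dots> = 0"
        by (intro sum.neutral ballI, subst x(2)) (auto simp: E_def)
      finally show ?thesis .
    qed
    have va: "vanish (l p) a p" if p: "p \<in> T" for p
      unfolding a_def
    proof (rule Ka[OF p])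
      fix i assume "i \<in> multi_indices (l p - 1)"
      then have "(\<Sum>j\<in>A. R (Inr (Inl (p, i))) j * x j) = 0" using p by (intro x(2)) (auto simp: E_def)
      then show "(\<Sum>a\<in>multi_indices D. Ka p i a * ca a) = 0"
        by (simp add: sumA R_def ca_def)
    qed
    have vb: "vanish (k p) b p" if p: "p \<in> T" for p
      unfolding b_def
    proof (rule Kb[OF p])
      fix i assume "i \<in> multi_indices (k p - 1)"
      then have "(\<Sum>j\<in>A. R (Inr (Inr (Inl (p, i)))) j * x j) = 0" using p by (intro x(2)) (auto simp: E_def)
      then show "(\<Sum>a\<in>multi_indices D. Kb p i a * cb a) = 0"
        by (simp add: sumA R_def cb_def)
    qed
    have caS: "ca s = 0" if "s \<in> S" for s
    proof -
      have "(\<Sum>j\<in>A. R (Inr (Inr (Inr s))) j * x j) = 0" using that by (intro x(2)) (auto simp: E_def)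
      then have "(\<Sum>a\<in>multi_indices D. if a = s then ca a else 0) = 0"
        by (simp add: sumA R_def ca_def if_distrib[of "\<lambda>r. r * _"] cong: if_cong)
      then show ?thesis using that S(1) finite_multi_indices[of D] by (auto split: if_splits)
    qed
    \<comment> \<open>All terms of the relation other than \<open>e q * g q\<close> vanish at
      \<open>q\<close> to order \<open>N q\<close>, hence so does this one. As \<open>e q\<close> is
      nonzero at \<open>q\<close>, the order passes to \<open>g q\<close>, whose degree is only
      \<open>N q - 1\<close>.\<close>
    have g0: "g q y = 0" if q: "q \<in> T" for q y
    proof -
      have e_eq: "(\<lambda>y. e q y * g q y)
          = (\<lambda>y. (-1) * (u y * a y + v y * b y + (\<Sum>p\<in>T - {q}. e p y * g p y)))"
        using rel fin q by (auto simp: fun_eq_iff sum.remove[of T q] algebra_simps eq_neg_iff_add_eq_0)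
      have "vanish (N q) (\<lambda>y. u y * a y) q"
        unfolding N_def using q by (intro vanish_mult k va)
      moreover have "vanish (N q) (\<lambda>y. v y * b y) q"
        unfolding N_def by (subst add.commute) (use q in \<open>intro vanish_mult l vb\<close>)
      moreover have "vanish (N q) (\<lambda>y. \<Sum>p\<in>T - {q}. e p y * g p y) q"
      proof (rule vanish_sum)
        fix p assume p: "p \<in> T - {q}"
        have "vanish (N q + 0) (\<lambda>y. e p y * g p y) q"
          using p q unfolding g_def by (intro vanish_mult e(3) vanish_0[OF form_in_forms]) auto
        then show "vanish (N q) (\<lambda>y. e p y * g p y) q" by simp
      qed
      ultimately have "vanish (0 + N q) (\<lambda>y. e q y * g q y) q"
        unfolding e_eq by (intro vanish_mult[OF vanish_0[OF forms_const]] vanish_add) 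
      then have "vanish (N q) (g q) q"
        using vanish_cancel[OF e(1)[OF q] _ e(2)[OF q], of "g q" "N q - 1"] by (simp add: g_def)
      then show ?thesis
        using vanish_above_degree[of "g q" "N q - 1" q y] N0[OF q] by (simp add: g_def)
    qed
    then have "u y * a y + v y * b y = 0" for y using rel[of y] by simp
    then obtain c where c: "c \<in> forms M" "\<And>y. a y = v y * c y" "\<And>y. b y = - (u y * c y)"
      using syz[of a M b] unfolding a_def b_def D_def by fastforce
    \<comment> \<open>The coefficients of \<open>a = v c\<close> in \<open>S\<close> are zero by the
      last group of equations, and \<open>S\<close> detects nonzero multiples of
      \<open>v\<close>.\<close>
    have "\<forall>y. c y = 0" by (rule S(3)[OF c(1), of ca]) (use c(2) caS a_def in auto)
    then have "a y = 0" "b y = 0" for y using c by auto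
    then have "ca i = 0" "cb i = 0" if "i \<in> multi_indices D" for i
      using form_zero_coeff that unfolding a_def b_def by blast+
    moreover have "cg p i = 0" if "p \<in> T" "i \<in> multi_indices (N p - 1)" for p i
      using form_zero_coeff that g0 unfolding g_def by blast
    ultimately have "\<forall>i\<in>A. x i = 0"
      by (auto simp: A_def ca_def cb_def cg_def)
    then show False using x(1) by blast
  qed
  then have "2 * card (multi_indices D) + (\<Sum>p\<in>T. card (multi_indices (N p - 1)))
      \<le> card (multi_indices d) + (\<Sum>p\<in>T. card (multi_indices (l p - 1)))
        + (\<Sum>p\<in>T. card (multi_indices (k p - 1))) + card (multi_indices M)"
    using S(2) fin finS unfolding A_def E_def
    by (simp add: card_Plus finite_multi_indices finite_SigmaI)
  \<comment> \<open>The source of the products: \<open>j * (j + 1) / 2\<close> at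
    \<open>j = k + l\<close> exceeds the sum of its values at \<open>k\<close> and \<open>l\<close>
    by \<open>k * l\<close>.\<close>
  moreover have "card (multi_indices (N p - 1))
      = card (multi_indices (l p - 1)) + card (multi_indices (k p - 1)) + k p * l p" if "p \<in> T" for p
  proof -
    have "2 * card (multi_indices (j - 1)) = j * (j + 1)" if "0 < j" for j
      using that by (simp add: card_multi_indices)
    from this[of "N p"] this[of "l p"] this[of "k p"] show ?thesis
      using k0[OF that] l0[OF that] by (simp add: N_def algebra_simps)
  qed
  ultimately have "2 * card (multi_indices D) + (\<Sum>p\<in>T. k p * l p)
      \<le> card (multi_indices d) + card (multi_indices M)"
    by (simp add: sum.distrib)
  \<comment> \<open>What remains is the second difference of \<open>(j + 1) * (j + 2) / 2\<close> at
    \<open>M\<close>, \<open>M + n\<close>, \<open>M + 2 * n\<close>, which is the square of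
    \<open>n\<close> whatever \<open>M\<close> is.\<close>
  then have "2 * (2 * card (multi_indices D)) + 2 * (\<Sum>p\<in>T. k p * l p)
      \<le> 2 * card (multi_indices d) + 2 * card (multi_indices M)" by simp
  then show ?thesis
    unfolding card_multi_indices by (simp add: d_def D_def algebra_simps power2_eq_square)
qed

text \<open>Points with a zero multiplicity add nothing to the sum and are discarded, since the
  count works with the degrees \<open>k p - 1\<close> and \<open>l p - 1\<close>.\<close>

lemma bezout_forms:
  fixes T :: "(real^3) set"
  assumes fin: "finite T" and unit: "\<And>p. p \<in> T \<Longrightarrow> norm p = 1" and anti: "\<And>p. p \<in> T \<Longrightarrow> - p \<notin> T"
    and u: "u \<in> forms n" and v: "v \<in> forms n" and nz: "v z \<noteq> 0"
    and k: "\<And>p. p \<in> T \<Longrightarrow> vanish (k p) u p" and l: "\<And>p. p \<in> T \<Longrightarrow> vanish (l p) v p"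
    and syz: "\<And>m a b. a \<in> forms (n + m) \<Longrightarrow> b \<in> forms (n + m) \<Longrightarrow> (\<And>x. u x * a x + v x * b x = 0)
      \<Longrightarrow> \<exists>c\<in>forms m. \<forall>x. a x = v x * c x \<and> b x = - (u x * c x)"
  shows "(\<Sum>p\<in>T. k p * l p) \<le> n\<^sup>2"
proof -
  define T' where "T' = {p \<in> T. 0 < k p \<and> 0 < l p}"
  have "(\<Sum>p\<in>T. k p * l p) = (\<Sum>p\<in>T'. k p * l p)"
    unfolding T'_def using fin by (intro sum.mono_neutral_right) auto
  also have "\<dots> \<le> n\<^sup>2"
    using fin unit anti k l by (intro bezout_forms_pos[OF _ _ _ u v nz _ _ _ _ syz]) (auto simp: T'_def)
  finally show ?thesis .
qed

section \<open>Syzygies of coprime forms\<close>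

lemma tdeg_le_mono: "tdeg_le m p \<Longrightarrow> m \<le> n \<Longrightarrow> tdeg_le n p"
  by (auto simp: tdeg_le_def)

lemma tdeg_le_uminus: "tdeg_le n (- p) \<longleftrightarrow> tdeg_le n p"
  by (simp add: tdeg_le_def)

lemma tdeg_le_0_unit:
  assumes "tdeg_le 0 p" "p \<noteq> 0" shows "is_unit p"
proof -
  have "coeff p (Suc j) = 0" for j using assms(1) by (auto simp: tdeg_le_def poly_eq_iff)
  then have "p = [:coeff p 0:]" by (auto simp: poly_eq_iff coeff_pCons split: nat.split)
  moreover have "coeff p 0 = [:coeff (coeff p 0) 0:]"
    using assms(1) by (auto simp: tdeg_le_def poly_eq_iff coeff_pCons split: nat.split)
  ultimately obtain r where r: "p = [:[:r:]:]" by metis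
  then have "p * [:[:1 / r:]:] = 1" using assms(2) by (simp add: one_pCons)
  then show ?thesis by (metis dvd_triv_left)
qed

lemma dehom_eq_0:
  assumes "f \<in> forms n" "dehom f 0" shows "f x = 0"
  using forms_dehom_eq[OF assms(1) forms_zero assms(2) dehom_zero] by simp

text \<open>A common factor \<open>x $ 3\<close> is not seen by the dehomogenisations; it is excluded by \<open>full\<close> in the proof.\<close>

lemma syzygy_trivial:
  assumes u: "u \<in> forms n" "u y \<noteq> 0" and v: "v \<in> forms n" "v z \<noteq> 0"
    and no_common: "\<And>m w f g. 1 \<le> m \<Longrightarrow> m \<le> n \<Longrightarrow> w \<in> forms m \<Longrightarrow> f \<in> forms (n - m) \<Longrightarrow> g \<in> forms (n - m)
      \<Longrightarrow> (\<And>x. u x = w x * f x) \<Longrightarrow> (\<And>x. v x = w x * g x) \<Longrightarrow> False"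
    and ab: "a \<in> forms (n + m)" "b \<in> forms (n + m)" "\<And>x. u x * a x + v x * b x = 0"
  shows "\<exists>c\<in>forms m. \<forall>x. a x = v x * c x \<and> b x = - (u x * c x)"
proof -
  obtain p where p: "tdeg_le n p" "dehom u p" using u(1) by (rule forms_dehomE)
  obtain q where q: "tdeg_le n q" "dehom v q" using v(1) by (rule forms_dehomE)
  have p0: "p \<noteq> 0" and q0: "q \<noteq> 0" using dehom_eq_0 p q u v by blast+
  have "coprime p q"
  proof -
    \<comment> \<open>With its exact total degree \<open>m\<close>, the gcd homogenises to a form
      that divides both \<open>u\<close> and \<open>v\<close>. By \<open>no_common\<close> this
      degree is 0, so the gcd is a unit.\<close>
    define g where "g = gcd p q"
    obtain p' q' where p': "p = g * p'" and q': "q = g * q'"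
      unfolding g_def by (meson dvdE gcd_dvd1 gcd_dvd2)
    have nz: "g \<noteq> 0" "p' \<noteq> 0" "q' \<noteq> 0" using p0 q0 p' q' by auto
    obtain m l where m: "tdeg_le m g" "tdeg_le l p'" "m + l = n" "\<And>k. tdeg_le k g \<Longrightarrow> m \<le> k"
      using tdeg_le_mult_split[OF nz(1,2)] p(1) p' by metis
    obtain m2 l2 where m2: "tdeg_le m2 g" "tdeg_le l2 q'" "m2 + l2 = n" "\<And>k. tdeg_le k g \<Longrightarrow> m2 \<le> k"
      using tdeg_le_mult_split[OF nz(1,3)] q(1) q' by metis
    have "m2 = m" using m(1,4) m2(1,4) by (meson antisym)
    then have l: "l = n - m" "l2 = n - m" "m \<le> n" using m(3) m2(3) by auto
    obtain w where w: "w \<in> forms m" "dehom w g" using tdeg_le_homE[OF m(1)] .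
    obtain f1 where f1: "f1 \<in> forms (n - m)" "dehom f1 p'" using tdeg_le_homE[OF m(2)] l by metis
    obtain f2 where f2: "f2 \<in> forms (n - m)" "dehom f2 q'" using tdeg_le_homE[OF m2(2)] l by metis
    have "(\<lambda>x. w x * f1 x) \<in> forms n" "(\<lambda>x. w x * f2 x) \<in> forms n"
      using forms_mult[OF w(1) f1(1)] forms_mult[OF w(1) f2(1)] l(3) by simp_all
    then have "u = (\<lambda>x. w x * f1 x)" "v = (\<lambda>x. w x * f2 x)"
      using forms_dehom_eq[OF u(1) _ p(2)] forms_dehom_eq[OF v(1) _ q(2)]
        dehom_mult[OF w(2) f1(2)] dehom_mult[OF w(2) f2(2)] p' q' by auto
    then have "m = 0" using no_common[OF _ l(3) w(1) f1(1) f2(1)] by fastforce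
    then have "is_unit g" using tdeg_le_0_unit m(1) nz(1) by blast
    then show ?thesis by (simp add: g_def coprime_iff_gcd_eq_1)
  qed
  have full: "\<not> (tdeg_le (n - 1) p \<and> tdeg_le (n - 1) q)" if n: "1 \<le> n"
  proof
    assume "tdeg_le (n - 1) p \<and> tdeg_le (n - 1) q"
    then obtain f1 f2 where f: "f1 \<in> forms (n - 1)" "dehom f1 p" "f2 \<in> forms (n - 1)" "dehom f2 q"
      by (meson tdeg_le_homE)
    have "(\<lambda>x. x $ 3 * f1 x) \<in> forms n" "(\<lambda>x. x $ 3 * f2 x) \<in> forms n"
      using forms_mult[OF forms_coord f(1), of 3] forms_mult[OF forms_coord f(3), of 3] n by simp_all
    moreover have "dehom (\<lambda>x. x $ 3 * f1 x) p" "dehom (\<lambda>x. x $ 3 * f2 x) q"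
      using f by (simp_all add: dehom_def)
    ultimately have "u = (\<lambda>x. x $ 3 * f1 x)" "v = (\<lambda>x. x $ 3 * f2 x)"
      using forms_dehom_eq u(1) v(1) p(2) q(2) by metis+
    then show False using no_common[OF order.refl n forms_coord f(1,3)] by metis
  qed
  obtain pa where pa: "tdeg_le (n + m) pa" "dehom a pa" using ab(1) by (rule forms_dehomE)
  obtain pb where pb: "tdeg_le (n + m) pb" "dehom b pb" using ab(2) by (rule forms_dehomE)
  have "dehom (\<lambda>x. u x * a x + v x * b x) (p * pa + q * pb)"
    by (intro dehom_add dehom_mult p q pa pb)
  then have rel: "p * pa + q * pb = 0" using ab(3) dehom_zero dehom_unique by simp
  then have "p * pa = q * (- pb)" by (simp add: eq_neg_iff_add_eq_0)
  then have "q dvd p * pa" by (metis dvd_triv_left)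
  then have "q dvd pa" using \<open>coprime p q\<close> by (simp add: coprime_dvd_mult_right_iff coprime_commute)
  then obtain c where c: "pa = q * c" by (auto elim: dvdE)
  then have "q * (p * c + pb) = 0" using rel by (simp add: algebra_simps)
  then have "pb = p * (- c)" using q0 by (simp add: eq_neg_iff_add_eq_0 add.commute)
  \<comment> \<open>By \<open>full\<close>, \<open>p\<close> or \<open>q\<close> has total degree
    exactly \<open>n\<close>; additivity of the degree in \<open>pb = p * (- c)\<close> or
    \<open>pa = q * c\<close> then leaves at most \<open>m\<close> for \<open>c\<close>.\<close>
  have "tdeg_le m c"
  proof (cases "c = 0")
    case True then show ?thesis by (simp add: tdeg_le_def)
  next
    case False
    obtain m1 l1 where 1: "tdeg_le m1 q" "tdeg_le l1 c" "m1 + l1 = n + m"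
      using tdeg_le_mult_split[OF q0 False] pa(1) c by metis
    obtain m2 l2 where 2: "tdeg_le m2 p" "tdeg_le l2 (- c)" "m2 + l2 = n + m"
      using tdeg_le_mult_split[OF p0, of "- c"] False pb(1) \<open>pb = p * (- c)\<close> by (metis neg_equal_0_iff_equal)
    consider "n \<le> m1" | "n \<le> m2" | "1 \<le> n" "m1 \<le> n - 1" "m2 \<le> n - 1" by linarith
    then show ?thesis
    proof cases
      case 3
      then show ?thesis using full 1(1) 2(1) tdeg_le_mono by blast
    qed (use 1 2 in \<open>auto intro: tdeg_le_mono simp: tdeg_le_uminus\<close>)
  qed
  then obtain h where h: "h \<in> forms m" "dehom h c" by (rule tdeg_le_homE)
  have "dehom (\<lambda>x. - (u x * h x)) pb"
    using dehom_mult[OF p(2) h(2)] \<open>pb = p * (- c)\<close> by (simp add: dehom_def eval2_uminus)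
  moreover have "(\<lambda>x. - (u x * h x)) \<in> forms (n + m)"
    using forms_scale[OF forms_mult[OF u(1) h(1)], of "-1"] by simp
  ultimately have "b = (\<lambda>x. - (u x * h x))" using forms_dehom_eq[OF ab(2)] pb(2) by blast
  moreover have "a = (\<lambda>x. v x * h x)"
    using forms_dehom_eq[OF ab(1) forms_mult[OF v(1) h(1)] pa(2)] dehom_mult[OF q(2) h(2)] c by simp
  ultimately show ?thesis using h(1) by auto
qed

section \<open>Partial derivatives of forms\<close>

definition pd :: "3 \<Rightarrow> (real^3 \<Rightarrow> real) \<Rightarrow> real^3 \<Rightarrow> real" where
  "pd i f x = vector_derivative (\<lambda>t. f (x + t *\<^sub>R axis i 1)) (at 0)"

lemma pdI: "((\<lambda>t. f (x + t *\<^sub>R axis i 1)) has_real_derivative D) (at 0) \<Longrightarrow> pd i f x = D"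
  unfolding pd_def has_real_derivative_iff_has_vector_derivative by (rule vector_derivative_at)

lemma forms_has_derivative_pd:
  assumes "f \<in> forms n"
  shows "((\<lambda>t. f (x + t *\<^sub>R axis i 1)) has_real_derivative pd i f x) (at 0)"
proof -
  obtain c where "f = form n c" using assms by (rule formsE)
  then have "(\<lambda>t. f (x + t *\<^sub>R axis i 1)) = poly (form_line n c x (axis i 1))"
    by (simp add: fun_eq_iff poly_form_line)
  then have "((\<lambda>t. f (x + t *\<^sub>R axis i 1)) has_real_derivative poly (pderiv (form_line n c x (axis i 1))) 0) (at 0)"
    by (simp add: poly_DERIV)
  then show ?thesis using pdI by metis
qed

lemma pd_add: "f \<in> forms m \<Longrightarrow> g \<in> forms n \<Longrightarrow> pd i (\<lambda>x. f x + g x) = (\<lambda>x. pd i f x + pd i g x)"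
  by (intro ext pdI DERIV_add forms_has_derivative_pd)

lemma pd_scale: "f \<in> forms m \<Longrightarrow> pd i (\<lambda>x. r * f x) = (\<lambda>x. r * pd i f x)"
  by (intro ext pdI DERIV_cmult forms_has_derivative_pd)

lemma pd_const: "pd i (\<lambda>x. r) = (\<lambda>x. 0)"
  by (intro ext pdI) simp

lemma pd_mult:
  "f \<in> forms m \<Longrightarrow> g \<in> forms n \<Longrightarrow> pd i (\<lambda>x. f x * g x) = (\<lambda>x. pd i f x * g x + f x * pd i g x)"
proof (intro ext pdI)
  fix x assume "f \<in> forms m" "g \<in> forms n"
  from DERIV_mult[OF this[THEN forms_has_derivative_pd]]
  show "((\<lambda>t. f (x + t *\<^sub>R axis i 1) * g (x + t *\<^sub>R axis i 1)) has_real_derivative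
      pd i f x * g x + f x * pd i g x) (at 0)" by (simp add: add.commute mult.commute)
qed

lemma mon_split: "mon a x = (x $ i) ^ a i * (\<Prod>j\<in>UNIV - {i}. (x $ j) ^ a j)"
  unfolding mon_def by (rule prod.remove) auto

lemma mon_fun_upd: "mon (a(i := k)) x = (x $ i) ^ k * (\<Prod>j\<in>UNIV - {i}. (x $ j) ^ a j)"
  by (subst mon_split[of _ _ i]) (auto intro!: arg_cong2[where f = "(*)"] prod.cong)

lemma pd_mon: "pd i (mon a) = (\<lambda>x. of_nat (a i) * mon (a(i := a i - 1)) x)"
proof (intro ext pdI)
  fix x :: "real^3"
  define C where "C = (\<Prod>j\<in>UNIV - {i}. (x $ j) ^ a j)"
  have "mon a (x + t *\<^sub>R axis i 1) = (x $ i + t) ^ a i * C" for t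
    unfolding C_def by (subst mon_split[of _ _ i]) (auto simp: axis_def intro!: prod.cong)
  moreover have "((\<lambda>t. (x $ i + t) ^ a i * C) has_real_derivative
      of_nat (a i) * ((x $ i) ^ (a i - 1) * C)) (at 0)"
    by (auto intro!: derivative_eq_intros)
  ultimately show "((\<lambda>t. mon a (x + t *\<^sub>R axis i 1)) has_real_derivative
      of_nat (a i) * mon (a(i := a i - 1)) x) (at 0)"
    by (simp add: mon_fun_upd C_def)
qed

lemma multi_indices_diff: "a \<in> multi_indices (Suc n) \<Longrightarrow> 0 < a i \<Longrightarrow> a(i := a i - 1) \<in> multi_indices n"
  using exhaust_3[of i] by (auto simp: mem_multi_indices)

lemma forms_pd: "f \<in> forms (Suc n) \<Longrightarrow> pd i f \<in> forms n"
proof (induction rule: forms_induct)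
  case (mon a)
  show ?case
  proof (cases "a i = 0")
    case True then show ?thesis by (simp add: pd_mon forms_zero)
  next
    case False
    then show ?thesis
      using mon multi_indices_diff by (auto simp: pd_mon intro!: forms_scale mon_in_forms)
  qed
qed (auto simp: pd_add pd_scale pd_const forms_add forms_scale forms_zero)

lemma pd_forms_0:
  assumes "f \<in> forms 0" shows "pd i f = (\<lambda>x. 0)"
proof -
  have "f = (\<lambda>x. f 0)" using forms_degree_0[OF assms] by blast
  then show ?thesis using pd_const[of i "f 0"] by simp
qed

text \<open>The truncated \<open>n - 1\<close> is right in degree 0 too, where the derivative is the
  zero form.\<close>

lemma forms_pd': "f \<in> forms n \<Longrightarrow> pd i f \<in> forms (n - 1)"
  by (cases n) (auto simp: pd_forms_0 forms_zero intro: forms_pd)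

lemma pd_sum:
  "(\<And>j. j \<in> J \<Longrightarrow> f j \<in> forms n) \<Longrightarrow> pd i (\<lambda>x. \<Sum>j\<in>J. f j x) = (\<lambda>x. \<Sum>j\<in>J. pd i (f j) x)"
proof (induction J rule: infinite_finite_induct)
  case (insert j J)
  then have "(\<lambda>x. \<Sum>j\<in>J. f j x) \<in> forms n" "f j \<in> forms n" by (auto intro: forms_sum)
  from pd_add[OF this(2,1), of i] show ?case using insert by simp
qed (simp_all add: pd_const)

lemma pd_commute: "f \<in> forms n \<Longrightarrow> pd i (pd j f) = pd j (pd i f)"
proof (induction rule: forms_induct)
  case (mon a)
  have "mon b \<in> forms (b 1 + b 2 + b 3)" for b
    by (rule mon_in_forms) (simp add: mem_multi_indices)
  then have "pd i (\<lambda>x. r * mon b x) = (\<lambda>x. r * pd i (mon b) x)" for i b r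
    by (rule pd_scale)
  then show ?case
    by (cases "i = j") (auto simp: pd_mon fun_upd_twist mult.left_commute)
next
  case (add f g)
  then show ?case by (simp add: pd_add[OF add(1,2)] pd_add[OF forms_pd' forms_pd'])
next
  case (scale r f)
  then show ?case by (simp add: pd_scale[OF scale(1)] pd_scale[OF forms_pd'])
qed (simp add: pd_const)

lemma euler: "f \<in> forms n \<Longrightarrow> (\<Sum>i\<in>UNIV. x $ i * pd i f x) = of_nat n * f x"
proof (induction rule: forms_induct)
  case (mon a)
  have "x $ i * pd i (mon a) x = of_nat (a i) * mon a x" for i
    unfolding pd_mon mon_fun_upd mon_split[of a x i] by (cases "a i") simp_all
  then have "(\<Sum>i\<in>UNIV. x $ i * pd i (mon a) x) = of_nat (\<Sum>i\<in>UNIV. a i) * mon a x"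
    by (simp add: sum_distrib_right)
  then show ?case using mon by (simp add: multi_indices_def flip: of_nat_sum)
next
  case (add f g)
  then show ?case by (simp add: pd_add[OF add(1,2)] distrib_left sum.distrib)
next
  case (scale r f)
  have "(\<Sum>i\<in>UNIV. x $ i * pd i (\<lambda>x. r * f x) x) = r * (\<Sum>i\<in>UNIV. x $ i * pd i f x)"
    by (simp add: pd_scale[OF scale(1)] sum_distrib_left mult.left_commute)
  then show ?case using scale by simp
qed (simp add: pd_const)

lemma DERIV_forms_line:
  assumes "f \<in> forms n"
  shows "((\<lambda>t. f (p + t *\<^sub>R y)) has_real_derivative (\<Sum>i\<in>UNIV. y $ i * pd i f (p + t *\<^sub>R y))) (at t)"
  using assms
proof (induction rule: forms_induct)
  case (mon a)
  show ?case
    unfolding pd_mon sum_3 unfolding mon_3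
    by (auto intro!: derivative_eq_intros simp: algebra_simps)
next
  case (add f g)
  then show ?case using DERIV_add by (simp add: pd_add[OF add(1,2)] distrib_left sum.distrib)
next
  case (scale r f)
  have "(\<Sum>i\<in>UNIV. y $ i * pd i (\<lambda>x. r * f x) (p + t *\<^sub>R y)) = r * (\<Sum>i\<in>UNIV. y $ i * pd i f (p + t *\<^sub>R y))"
    by (simp add: pd_scale[OF scale(1)] sum_distrib_left mult.left_commute)
  then show ?case using DERIV_cmult[OF scale(2)] by simp
qed (simp add: pd_const)

text \<open>Links the order defined by iterated derivatives to \<open>vanish\<close>. By induction
  every partial derivative vanishes to order \<open>k\<close>, so the derivative along a line is
  divisible by the power \<open>k\<close> of \<open>t\<close>; since \<open>f p = 0\<close>,
  integration gains one order.\<close>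

lemma vanish_of_derivatives:
  assumes "f \<in> forms n" "\<And>js. length js < k \<Longrightarrow> foldr pd js f p = 0"
  shows "vanish k f p"
  using assms
proof (induction k arbitrary: f n)
  case 0 then show ?case using vanish_0 by blast
next
  case (Suc k)
  obtain c where c: "f = form n c" using Suc.prems(1) by (rule formsE)
  \<comment> \<open>\<open>foldr\<close> applies the last entry of the list first, so
    \<open>i\<close> is appended at the end.\<close>
  have vi: "vanish k (pd i f) p" for i
    using Suc.IH[OF forms_pd'[OF Suc.prems(1)]] Suc.prems(2)[of "_ @ [i]"] by simp
  show ?case
    unfolding c vanish_form_iff
  proof (intro allI impI)
    fix y j assume j: "j < Suc k"
    let ?L = "form_line n c p y"
    show "coeff ?L j = 0"
    proof (cases j)
      case 0
      then show ?thesis using Suc.prems(2)[of "[]"] poly_form_line[of n c p y 0] by (simp add: c poly_0_coeff_0)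
    next
      case (Suc j')
      have "\<exists>r. \<forall>t. pd i f (p + t *\<^sub>R y) = t ^ k * poly r t" for i
        using vi by (simp add: vanish_def)
      then obtain r where r: "\<And>i t. pd i f (p + t *\<^sub>R y) = t ^ k * poly (r i) t" by metis
      have "pderiv ?L = monom 1 k * (\<Sum>i\<in>UNIV. smult (y $ i) (r i))"
      proof (rule poly_ext)
        fix t
        have "(\<lambda>t. f (p + t *\<^sub>R y)) = poly ?L" by (simp add: fun_eq_iff poly_form_line c)
        then have "(poly ?L has_real_derivative (\<Sum>i\<in>UNIV. y $ i * pd i f (p + t *\<^sub>R y))) (at t)"
          using DERIV_forms_line[OF Suc.prems(1), of p y t] by simp
        then have "poly (pderiv ?L) t = (\<Sum>i\<in>UNIV. y $ i * pd i f (p + t *\<^sub>R y))"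
          using poly_DERIV DERIV_unique by blast
        then show "poly (pderiv ?L) t = poly (monom 1 k * (\<Sum>i\<in>UNIV. smult (y $ i) (r i))) t"
          by (simp add: r poly_monom poly_sum sum_distrib_left mult_ac)
      qed
      then have "coeff (pderiv ?L) j' = 0" using j Suc by (simp add: coeff_monom_mult)
      then show ?thesis by (simp add: coeff_pderiv Suc)
    qed
  qed
qed

section \<open>Gaussian expectation\<close>

definition gauss1 :: "(real \<Rightarrow> real) \<Rightarrow> real" where
  "gauss1 g = (\<integral>t. std_normal_density t * g t \<partial>lborel)"

definition gauss_moment :: "nat \<Rightarrow> real" where
  "gauss_moment k = gauss1 (\<lambda>t. t ^ k)"

text \<open>The expectation over three independent standard normal variables, as iterated integrals:
  on forms each of them is a finite sum of moments.\<close>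

definition gauss :: "(real^3 \<Rightarrow> real) \<Rightarrow> real" where
  "gauss f = gauss1 (\<lambda>x. gauss1 (\<lambda>y. gauss1 (\<lambda>z. f (vector [x, y, z]))))"

text \<open>One-dimensional Gaussian integration by parts for powers, read off from the closed
  formulas for the moments. At \<open>k = 0\<close> the factor \<open>of_nat k\<close> cancels the
  truncated \<open>k - 1\<close>.\<close>

lemma gauss_moment_Suc: "gauss_moment (Suc k) = of_nat k * gauss_moment (k - 1)"
proof (cases "even k")
  case True
  then obtain j where j: "k = 2 * j" by blast
  have "gauss_moment (Suc k) = 0"
    using integral_std_normal_moment_odd[of j] by (simp add: gauss_moment_def gauss1_def j)
  moreover have "of_nat k * gauss_moment (k - 1) = 0"
  proof (cases j)
    case (Suc i)
    then have "k - 1 = 2 * i + 1" by (simp add: j)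
    then show ?thesis
      using integral_std_normal_moment_odd[of i] by (simp add: gauss_moment_def gauss1_def)
  qed (simp add: j)
  ultimately show ?thesis by simp
next
  case False
  then obtain j where j: "k = 2 * j + 1" by (auto elim: oddE)
  have e: "gauss_moment (2 * i) = fact (2 * i) / (2 ^ i * fact i)" for i
    using integral_std_normal_moment_even[of i] by (simp add: gauss_moment_def gauss1_def)
  have "gauss_moment (Suc k) = gauss_moment (2 * Suc j)" by (simp add: j)
  also have "\<dots> = of_nat (2 * j + 1) * gauss_moment (2 * j)"
  proof -
    have 1: "fact (2 * Suc j) = (2 * real j + 2) * ((2 * real j + 1) * fact (2 * j))"
      by (simp add: algebra_simps)
    have 2: "2 ^ Suc j * fact (Suc j) = (2 * real j + 2) * (2 ^ j * fact j)"
      by (simp add: algebra_simps)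
    have "(2 * real j + 2) * x / ((2 * real j + 2) * y) = x / y" for x y
      by (intro mult_divide_mult_cancel_left) linarith
    then show ?thesis unfolding e 1 2 by simp
  qed
  finally show ?thesis by (simp add: j)
qed

lemma integrable_gauss_sum:
  "integrable lborel (\<lambda>t. std_normal_density t * (\<Sum>i\<in>I. r i * t ^ e i))"
  unfolding sum_distrib_left mult.left_commute[of _ "r _"]
  by (intro Bochner_Integration.integrable_sum integrable_mult_right integrable_std_normal_moment)

lemma gauss1_sum: "gauss1 (\<lambda>t. \<Sum>i\<in>I. r i * t ^ e i) = (\<Sum>i\<in>I. r i * gauss_moment (e i))"
  unfolding gauss1_def gauss_moment_def sum_distrib_left mult.left_commute[of _ "r _"]
  by (subst Bochner_Integration.integral_sum)
    (auto intro!: integrable_mult_right integrable_std_normal_moment)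

lemma gauss1_nonneg: "(\<And>t. 0 \<le> g t) \<Longrightarrow> 0 \<le> gauss1 g"
  unfolding gauss1_def by (intro Bochner_Integration.integral_nonneg) (simp add: normal_density_nonneg)

text \<open>The density is positive, so a nonnegative integrand with integral 0 vanishes almost
  everywhere. A nonzero polynomial has only finitely many roots, a null set.\<close>

lemma gauss1_eq_0:
  assumes nn: "\<And>t. 0 \<le> (\<Sum>i\<in>I. r i * t ^ e i)" and 0: "gauss1 (\<lambda>t. \<Sum>i\<in>I. r i * t ^ e i) = 0"
  shows "(\<Sum>i\<in>I. r i * t ^ e i) = (0::real)"
proof -
  define P where "P = (\<Sum>i\<in>I. monom (r i) (e i))"
  have P: "poly P t = (\<Sum>i\<in>I. r i * t ^ e i)" for t
    by (simp add: P_def poly_sum poly_monom)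
  have "AE t in lborel. std_normal_density t * poly P t = 0"
    using 0 integrable_gauss_sum[where I = I and r = r and e = e] nn
    by (subst (asm) gauss1_def, subst (asm) integral_nonneg_eq_0_iff_AE) (auto simp: P normal_density_nonneg)
  then have AE: "AE t in lborel. poly P t = 0"
    by eventually_elim (use normal_density_pos[of 1 0] in \<open>auto simp: less_le\<close>)
  have "P = 0"
  proof (rule ccontr)
    assume "P \<noteq> 0"
    then have "finite {t. poly P t = 0}" by (rule poly_roots_finite)
    then have "{t. poly P t = 0} \<in> null_sets lborel" by (rule finite_imp_null_set_lborel)
    then have "AE t in lborel. poly P t \<noteq> 0" using AE_not_in[of "{t. poly P t = 0}" lborel] by simp
    with AE have "AE t in lborel :: real measure. False" by eventually_elim auto
    then show False by (simp add: AE_iff_null null_sets_def)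
  qed
  then show ?thesis using P by simp
qed

lemma form_vector: "form n c (vector [x, y, z]) = (\<Sum>a\<in>multi_indices n. c a * x ^ a 1 * y ^ a 2 * z ^ a 3)"
  by (simp add: form_def mon_3 mult.assoc)

text \<open>The power of the next variable is put last, so that \<open>gauss1_sum\<close> and
  \<open>gauss1_eq_0\<close> apply again.\<close>

lemma gauss_inner1: "gauss1 (\<lambda>z. form n c (vector [x, y, z]))
    = (\<Sum>a\<in>multi_indices n. c a * x ^ a 1 * gauss_moment (a 3) * y ^ a 2)"
proof -
  have "gauss1 (\<lambda>z. form n c (vector [x, y, z]))
      = (\<Sum>a\<in>multi_indices n. (c a * x ^ a 1 * y ^ a 2) * gauss_moment (a 3))"
    unfolding form_vector by (rule gauss1_sum)
  also have "\<dots> = (\<Sum>a\<in>multi_indices n. c a * x ^ a 1 * gauss_moment (a 3) * y ^ a 2)"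
    by (intro sum.cong refl) (simp only: mult_ac)
  finally show ?thesis .
qed

lemma gauss_inner2: "gauss1 (\<lambda>y. gauss1 (\<lambda>z. form n c (vector [x, y, z])))
    = (\<Sum>a\<in>multi_indices n. c a * gauss_moment (a 2) * gauss_moment (a 3) * x ^ a 1)"
proof -
  have "gauss1 (\<lambda>y. gauss1 (\<lambda>z. form n c (vector [x, y, z])))
      = (\<Sum>a\<in>multi_indices n. (c a * x ^ a 1 * gauss_moment (a 3)) * gauss_moment (a 2))"
    unfolding gauss_inner1 by (rule gauss1_sum)
  also have "\<dots> = (\<Sum>a\<in>multi_indices n. c a * gauss_moment (a 2) * gauss_moment (a 3) * x ^ a 1)"
    by (intro sum.cong refl) (simp only: mult_ac)
  finally show ?thesis .
qed

lemma gauss_form: "gauss (form n c) = (\<Sum>a\<in>multi_indices n. c a * (\<Prod>i\<in>UNIV. gauss_moment (a i)))"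
proof -
  have "gauss (form n c)
      = (\<Sum>a\<in>multi_indices n. (c a * gauss_moment (a 2) * gauss_moment (a 3)) * gauss_moment (a 1))"
    unfolding gauss_def gauss_inner2 by (rule gauss1_sum)
  also have "\<dots> = (\<Sum>a\<in>multi_indices n. c a * (\<Prod>i\<in>UNIV. gauss_moment (a i)))"
    unfolding UNIV_3 by (intro sum.cong refl) (simp add: mult.commute mult.left_commute)
  finally show ?thesis .
qed

text \<open>The one-variable statement is applied from the outermost integral inwards; the inner
  integrals are nonnegative polynomials.\<close>

lemma gauss_eq_0:
  assumes "f \<in> forms n" "\<And>x. 0 \<le> f x" "gauss f = 0"
  shows "f w = 0"
proof -
  obtain c where c: "f = form n c" using assms(1) by (rule formsE)
  let ?f = "\<lambda>x y z. form n c (vector [x, y, z])"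
  have nn: "0 \<le> ?f x y z" "0 \<le> gauss1 (\<lambda>z. ?f x y z)" "0 \<le> gauss1 (\<lambda>y. gauss1 (\<lambda>z. ?f x y z))" for x y z
    using assms(2) by (auto simp: c intro!: gauss1_nonneg)
  have 1: "gauss1 (\<lambda>y. gauss1 (\<lambda>z. ?f x y z)) = 0" for x
    using nn(3) assms(3) unfolding c gauss_def gauss_inner2 by (rule gauss1_eq_0)
  have 2: "gauss1 (\<lambda>z. ?f x y z) = 0" for x y
    using nn(2)[of x] 1[of x] unfolding gauss_inner1 by (rule gauss1_eq_0)
  have 3: "?f x y z = 0" for x y z
    using nn(1)[of x y] 2[of x y] unfolding form_vector by (rule gauss1_eq_0)
  have "w = vector [w $ 1, w $ 2, w $ 3]" by (simp add: vec_eq_iff forall_3)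
  then show ?thesis using 3 by (metis c)
qed

lemma gauss_add:
  assumes "f \<in> forms n" "g \<in> forms n"
  shows "gauss (\<lambda>x. f x + g x) = gauss f + gauss g"
proof -
  obtain c where c: "f = form n c" using assms(1) by (rule formsE)
  obtain d where d: "g = form n d" using assms(2) by (rule formsE)
  have "(\<lambda>x. f x + g x) = form n (\<lambda>a. c a + d a)"
    unfolding c d form_def fun_eq_iff by (simp add: distrib_right sum.distrib)
  then have "gauss (\<lambda>x. f x + g x) = gauss (form n (\<lambda>a. c a + d a))" by simp
  then show ?thesis unfolding c d gauss_form by (simp add: distrib_right sum.distrib)
qed

lemma gauss_scale:
  assumes "f \<in> forms n" shows "gauss (\<lambda>x. r * f x) = r * gauss f"
proof -
  obtain c where c: "f = form n c" using assms by (rule formsE)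
  have "(\<lambda>x. r * f x) = form n (\<lambda>a. r * c a)"
    unfolding c form_def fun_eq_iff sum_distrib_left by (simp add: mult.assoc)
  then have "gauss (\<lambda>x. r * f x) = gauss (form n (\<lambda>a. r * c a))" by simp
  then show ?thesis unfolding c gauss_form sum_distrib_left by (simp add: mult.assoc)
qed

lemma gauss_zero: "gauss (\<lambda>x. 0) = 0"
  by (simp add: gauss_def gauss1_def)

lemma gauss_sum:
  "(\<And>i. i \<in> I \<Longrightarrow> f i \<in> forms n) \<Longrightarrow> gauss (\<lambda>x. \<Sum>i\<in>I. f i x) = (\<Sum>i\<in>I. gauss (f i))"
proof (induction I rule: infinite_finite_induct)
  case (insert i I)
  then have "(\<lambda>x. \<Sum>i\<in>I. f i x) \<in> forms n" "f i \<in> forms n" by (auto intro: forms_sum)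
  from gauss_add[OF this(2,1)] show ?case using insert by simp
qed (simp_all add: gauss_zero)

lemma gauss_mon: "gauss (mon a) = (\<Prod>i\<in>UNIV. gauss_moment (a i))"
proof -
  define n where "n = a 1 + a 2 + a 3"
  have a: "a \<in> multi_indices n" by (simp add: mem_multi_indices n_def)
  define c where "c = (\<lambda>b. if b = a then 1 else (0::real))"
  have *: "(\<Sum>b\<in>multi_indices n. c b * h b) = h a" for h :: "_ \<Rightarrow> real"
    using a finite_multi_indices[of n] by (simp add: c_def if_distrib[of "\<lambda>r. r * _"] cong: if_cong)
  have "mon a = form n c" unfolding fun_eq_iff form_def * by simp
  then have "gauss (mon a) = gauss (form n c)" by (rule arg_cong)
  then show ?thesis unfolding gauss_form * .
qed

text \<open>The Gaussian integral of a monomial is a product of moments, and only the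
  \<open>i\<close>-th factor is affected, by the recursion \<open>gauss_moment_Suc\<close>.\<close>

lemma gauss_by_parts:
  assumes "f \<in> forms n"
  shows "gauss (\<lambda>x. x $ i * f x) = gauss (pd i f)"
  using assms
proof (induction rule: forms_induct)
  case (mon a)
  define C where "C = (\<Prod>j\<in>UNIV - {i}. gauss_moment (a j))"
  have g: "gauss (mon (a(i := k))) = gauss_moment k * C" for k
    unfolding gauss_mon C_def
    by (subst prod.remove[of _ i]) (auto intro!: arg_cong2[where f = "(*)"] prod.cong)
  have "(\<lambda>x. x $ i * mon a x) = mon (a(i := Suc (a i)))"
    by (rule ext, subst mon_split[of _ _ i]) (simp add: mon_fun_upd)
  then have "gauss (\<lambda>x. x $ i * mon a x) = of_nat (a i) * gauss (mon (a(i := a i - 1)))"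
    by (simp add: g gauss_moment_Suc)
  also have "\<dots> = gauss (pd i (mon a))"
    using gauss_scale[OF mon_in_forms[of "a(i := a i - 1)"]] 
    by (simp add: pd_mon mem_multi_indices)
  finally show ?case .
next
  case (add f g)
  then show ?case
    by (simp add: distrib_left pd_add[OF add(1,2)] gauss_add[OF forms_pd' forms_pd']
        gauss_add[OF forms_mult[OF forms_coord] forms_mult[OF forms_coord]])
next
  case (scale r f)
  then show ?case
    by (simp add: mult.left_commute pd_scale[OF scale(1)] gauss_scale[OF forms_pd']
        gauss_scale[OF forms_mult[OF forms_coord]])
qed (simp add: pd_const)

lemma harmonic_pd:
  assumes "u \<in> forms n" "\<And>x. (\<Sum>i\<in>UNIV. pd i (pd i u) x) = 0"
  shows "(\<Sum>i\<in>UNIV. pd i (pd i (pd j u)) x) = 0"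
proof -
  have "pd i (pd i (pd j u)) = pd j (pd i (pd i u))" for i
    using pd_commute[OF assms(1)] pd_commute[OF forms_pd'[OF assms(1)]] by metis
  then have "(\<Sum>i\<in>UNIV. pd i (pd i (pd j u)) x) = pd j (\<lambda>x. \<Sum>i\<in>UNIV. pd i (pd i u) x) x"
    by (subst pd_sum[OF forms_pd'[OF forms_pd'[OF assms(1)]]]) simp
  then show ?thesis using assms(2) by (simp add: pd_const)
qed

text \<open>Euler's relation writes \<open>n u\<close> as the sum of
  \<open>x $ i * pd i u x\<close>, and integration by parts turns this into the integral of the
  Laplacian of \<open>u\<close> times \<open>a\<close>, plus the terms in
  \<open>cross\<close>.\<close>

lemma gauss_harmonic_mult_eq_0:
  assumes u: "u \<in> forms n" and harm: "\<And>x. (\<Sum>i\<in>UNIV. pd i (pd i u) x) = 0"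
    and a: "a \<in> forms k" and kn: "k < n"
    and cross: "\<And>i. gauss (\<lambda>x. pd i u x * pd i a x) = 0"
  shows "gauss (\<lambda>x. u x * a x) = 0"
proof -
  have d: "pd i u \<in> forms (n - 1)" "pd i (pd i u) \<in> forms (n - 2)" for i
    using forms_pd'[OF u] forms_pd'[OF forms_pd'[OF u]] by (simp_all add: numeral_2_eq_2)
  have pa: "(\<lambda>x. pd i u x * a x) \<in> forms (n - 1 + k)" for i by (intro forms_mult d a)
  have xpa: "(\<lambda>x. x $ i * (pd i u x * a x)) \<in> forms (1 + (n - 1 + k))" for i
    by (intro forms_mult[OF forms_coord] pa)
  have "of_nat n * gauss (\<lambda>x. u x * a x) = gauss (\<lambda>x. (of_nat n * u x) * a x)"
    using gauss_scale[OF forms_mult[OF u a]] by (simp add: mult.assoc)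
  also have "(\<lambda>x. (of_nat n * u x) * a x) = (\<lambda>x. \<Sum>i\<in>UNIV. x $ i * (pd i u x * a x))"
    by (simp add: euler[OF u, symmetric] sum_distrib_right mult.assoc)
  also have "gauss \<dots> = (\<Sum>i\<in>UNIV. gauss (pd i (\<lambda>x. pd i u x * a x)))"
    using xpa by (simp add: gauss_sum[of UNIV _ "1 + (n - 1 + k)"] gauss_by_parts[OF pa])
  also have "\<dots> = (\<Sum>i\<in>UNIV. gauss (\<lambda>x. pd i (pd i u) x * a x) + gauss (\<lambda>x. pd i u x * pd i a x))"
  proof (intro sum.cong refl)
    fix i
    show "gauss (pd i (\<lambda>x. pd i u x * a x))
        = gauss (\<lambda>x. pd i (pd i u) x * a x) + gauss (\<lambda>x. pd i u x * pd i a x)"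
    \<comment> \<open>\<open>gauss_add\<close> needs summands of equal degree. In the first case one
      summand is zero; otherwise neither degree is truncated and they agree.\<close>
    proof (cases "k = 0 \<or> n = 1")
      case True
      then have "pd i (pd i u) = (\<lambda>x. 0) \<or> pd i a = (\<lambda>x. 0)"
        using pd_forms_0 a d(1)[of i] by auto
      then show ?thesis by (auto simp: pd_mult[OF d(1) a] gauss_zero)
    next
      case False
      then have "n - 2 + k = n - 1 + (k - 1)" using kn by linarith
      then have "(\<lambda>x. pd i (pd i u) x * a x) \<in> forms (n - 1 + (k - 1))"
        using forms_mult[OF d(2) a] by metis
      moreover have "(\<lambda>x. pd i u x * pd i a x) \<in> forms (n - 1 + (k - 1))"
        by (intro forms_mult d forms_pd' a)
      ultimately show ?thesis by (simp add: pd_mult[OF d(1) a] gauss_add)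
    qed
  qed
  also have "\<dots> = (\<Sum>i\<in>UNIV. gauss (\<lambda>x. pd i (pd i u) x * a x))" by (simp add: cross)
  also have "\<dots> = gauss (\<lambda>x. (\<Sum>i\<in>UNIV. pd i (pd i u) x) * a x)"
    using gauss_sum[of UNIV "\<lambda>i x. pd i (pd i u) x * a x", OF forms_mult[OF d(2) a]]
    by (simp add: sum_distrib_right)
  also have "\<dots> = 0" by (simp add: harm gauss_zero)
  finally show ?thesis using kn by simp
qed

text \<open>Differentiation keeps \<open>u\<close> harmonic and lowers both degrees by one, so the
  cross terms vanish by induction on \<open>k\<close>.\<close>

lemma harmonic_orthogonal_lower_degree:
  assumes "u \<in> forms n" "\<And>x. (\<Sum>i\<in>UNIV. pd i (pd i u) x) = 0" "a \<in> forms k" "k < n"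
  shows "gauss (\<lambda>x. u x * a x) = 0"
  using assms
proof (induction k arbitrary: n u a)
  case 0
  then show ?case
    by (intro gauss_harmonic_mult_eq_0[OF 0]) (simp add: pd_forms_0 gauss_zero)
next
  case (Suc k)
  have "gauss (\<lambda>x. pd i u x * pd i a x) = 0" for i
    by (rule Suc.IH[OF forms_pd'[OF Suc.prems(1)] harmonic_pd[OF Suc.prems(1,2)] forms_pd[OF Suc.prems(3)]])
      (use Suc.prems(4) in simp)
  then show ?case by (rule gauss_harmonic_mult_eq_0[OF Suc.prems])
qed

section \<open>Zeros of factors of harmonic forms\<close>

text \<open>Otherwise finitely many subspaces of dimension at most 2 would cover the nonempty open
  set where \<open>w\<close> is positive.\<close>

lemma forms_sign_change_infinite_zeros:
  assumes w: "w \<in> forms m" and pos: "0 < w p" and neg: "w q < 0"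
  shows "infinite {x \<in> sphere 0 1. w x = 0}"
proof
  define Z where "Z = {x \<in> sphere 0 1. w x = 0}"
  assume "finite {x \<in> sphere 0 1. w x = 0}"
  then have fin: "finite Z" by (simp add: Z_def)
  have cont: "continuous_on UNIV w" using w by (rule continuous_on_forms)
  txt \<open>A segment from \<open>q\<close> to a point \<open>x\<close> with \<open>0 < w x\<close> meets a zero of \<open>w\<close>, so \<open>x\<close> lies in the plane
    spanned by \<open>q\<close> and this zero.\<close>
  have "{x. 0 < w x} \<subseteq> (\<Union>z\<in>insert 0 Z. span {q, z})"
  proof
    fix x assume "x \<in> {x. 0 < w x}"
    then have x: "0 < w x" by simp
    define h where "h s = (1 - s) *\<^sub>R q + s *\<^sub>R x" for s :: real
    have "continuous_on {0..1} (\<lambda>s. w (h s))"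
      unfolding h_def by (rule continuous_on_compose2[OF cont]) (auto intro!: continuous_intros)
    then obtain s where s: "0 \<le> s" "s \<le> 1" "w (h s) = 0"
      using IVT'[of "\<lambda>s. w (h s)" 0 0 1] neg x by (auto simp: h_def)
    then have "s \<noteq> 0" using neg by (auto simp: h_def)
    then have xh: "x = (1 / s) *\<^sub>R h s - ((1 - s) / s) *\<^sub>R q"
      by (simp add: h_def scaleR_add_right)
    show "x \<in> (\<Union>z\<in>insert 0 Z. span {q, z})"
    \<comment> \<open>The segment may pass through the origin, which has no projection to the
      sphere; this is why 0 is added to \<open>Z\<close>.\<close>
    proof (cases "h s = 0")
      case True
      then have "x \<in> span {q, 0}" by (subst xh) (auto intro: span_neg span_scale span_base)
      then show ?thesis by blast
    next
      case False
      define z where "z = (1 / norm (h s)) *\<^sub>R h s"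
      have "z \<in> Z" using False s(3) by (simp add: Z_def z_def forms_homogeneous[OF w])
      moreover have "h s = norm (h s) *\<^sub>R z" using False by (simp add: z_def)
      then have "h s \<in> span {q, z}" by (metis insertI1 insert_commute span_base span_scale)
      then have "x \<in> span {q, z}" by (subst xh) (auto intro!: span_diff span_scale intro: span_base)
      ultimately show ?thesis by blast
    qed
  qed
  moreover have "negligible (\<Union>z\<in>insert 0 Z. span {q, z})"
  proof (rule negligible_Union)
    show "finite ((\<lambda>z. span {q, z}) ` insert 0 Z)" using fin by simp
    fix t assume "t \<in> (\<lambda>z. span {q, z}) ` insert 0 Z"
    then obtain z where t: "t = span {q, z}" by blast
    have "card {q, z} \<le> 2" by (cases "q = z") auto
    then have "dim {q, z} \<le> 2" using dim_le_card'[of "{q, z}"] by simp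
    then show "negligible t" unfolding t by (intro negligible_lowdim) simp
  qed
  ultimately have "negligible {x. 0 < w x}" by (rule negligible_subset[rotated])
  moreover have "open {x. 0 < w x}" using cont by (intro open_Collect_less continuous_on_const)
  ultimately show False using open_not_negligible pos by blast
qed

lemma infinite_sphere_3: "infinite (sphere 0 1 :: (real^3) set)"
proof -
  have "infinite {x :: real^3. x \<in> sphere 0 1 \<and> x $ 1 = 0}"
    using forms_sign_change_infinite_zeros[OF forms_coord, of "axis 1 1" 1 "- axis 1 1"] by simp
  then show ?thesis by (rule infinite_super[rotated]) auto
qed

text \<open>If \<open>w\<close> had constant sign, then so would \<open>u * f = w * f\<^sup>2\<close>, whose Gaussian integral vanishes.\<close>

lemma harmonic_factor_infinite_zeros:
  assumes u: "u \<in> forms n" "\<And>x. (\<Sum>i\<in>UNIV. pd i (pd i u) x) = 0" "u y \<noteq> 0"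
    and m: "1 \<le> m" "m \<le> n" and w: "w \<in> forms m" and f: "f \<in> forms (n - m)"
    and eq: "\<And>x. u x = w x * f x"
  shows "infinite {x \<in> sphere 0 1. w x = 0}"
proof (cases "(\<exists>p. 0 < w p) \<and> (\<exists>q. w q < 0)")
  case True
  then show ?thesis using forms_sign_change_infinite_zeros[OF w] by blast
next
  case False
  then obtain s :: real where s: "s \<noteq> 0" "\<And>x. 0 \<le> s * w x"
    by (metis linorder_not_less mult_1 mult_minus1 neg_0_le_iff_le zero_neq_neg_one zero_neq_one)
  have uf: "(\<lambda>x. u x * f x) \<in> forms (n + (n - m))" using u(1) f by (rule forms_mult)
  have "u x * f x = 0" for x
  proof -
    \<comment> \<open>Since \<open>1 \<le> m\<close>, the degree \<open>n - m\<close> of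
      \<open>f\<close> is below that of \<open>u\<close>.\<close>
    have "gauss (\<lambda>x. s * (u x * f x)) = 0"
      using gauss_scale[OF uf] harmonic_orthogonal_lower_degree[OF u(1,2) f] m by simp
    moreover have "0 \<le> s * (u x * f x)" for x
    proof -
      have "0 \<le> (s * w x) * (f x)\<^sup>2" by (rule mult_nonneg_nonneg[OF s(2) zero_le_power2])
      then show ?thesis by (simp add: eq power2_eq_square mult.assoc)
    qed
    ultimately have "s * (u x * f x) = 0" by (intro gauss_eq_0[OF forms_scale[OF uf]])
    then show ?thesis using s(1) by simp
  qed
  then have "(\<forall>x. u x = 0) \<or> (\<forall>x. f x = 0)" by (rule forms_mult_eq_0[OF u(1) f])
  then have "u y = 0" unfolding eq by auto
  then show ?thesis using u(3) by simp
qed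

section \<open>From complex harmonic polynomials to real forms\<close>

lemma partial_derivative_of_real:
  "f \<in> forms n \<Longrightarrow> partial_derivative i (\<lambda>x. complex_of_real (f x)) = (\<lambda>x. complex_of_real (pd i f x))"
  unfolding partial_derivative_def
  by (intro ext vector_derivative_at has_vector_derivative_of_real forms_has_derivative_pd)

lemma iterated_partial_derivative_of_real:
  assumes "f \<in> forms n"
  shows "foldr partial_derivative js (\<lambda>x. complex_of_real (f x)) = (\<lambda>x. complex_of_real (foldr pd js f x))
    \<and> (\<exists>m. foldr pd js f \<in> forms m)"
  using assms by (induction js) (auto simp: partial_derivative_of_real dest: forms_pd')

text \<open>The last conclusion covers \<open>u = 0\<close> as well: whatever the value of the
  \<open>LEAST\<close>, derivatives of smaller order vanish.\<close>

lemma real_harmonic_polynomialE: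
  assumes "u \<in> harmonic_polynomials n" "real_valued u"
  obtains f where "f \<in> forms n" "u = (\<lambda>x. complex_of_real (f x))"
    "\<And>x. (\<Sum>i\<in>UNIV. pd i (pd i f) x) = 0" "\<And>p. vanish (vanishing_order u p) f p"
proof -
  obtain c where c: "\<And>x. u x = (\<Sum>a\<in>multi_indices n. c a * complex_of_real (\<Prod>i\<in>UNIV. (x $ i) ^ a i))"
    using assms(1) unfolding harmonic_polynomials_def homogeneous_polynomial_def by blast
  define f where "f = form n (\<lambda>a. Re (c a))"
  have f: "f \<in> forms n" by (simp add: f_def)
  have "Re (u x) = f x" for x
    unfolding c f_def form_def mon_def by (simp del: of_real_prod of_real_power)
  then have u: "u = (\<lambda>x. complex_of_real (f x))"
    using assms(2) unfolding real_valued_def by (metis of_real_Re)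
  show ?thesis
  proof (rule that[OF f u])
    fix x
    have "complex_of_real (\<Sum>i\<in>UNIV. pd i (pd i f) x) = laplacian u x"
      unfolding laplacian_def u
      by (simp add: partial_derivative_of_real[OF f] partial_derivative_of_real[OF forms_pd'[OF f]])
    also have "laplacian u x = 0" using assms(1) by (simp add: harmonic_polynomials_def)
    finally show "(\<Sum>i\<in>UNIV. pd i (pd i f) x) = 0" by (simp only: of_real_eq_0_iff)
  next
    fix p
    show "vanish (vanishing_order u p) f p"
    proof (rule vanish_of_derivatives[OF f])
      fix js :: "3 list" assume "length js < vanishing_order u p"
      then have "foldr partial_derivative js u p = 0"
        unfolding vanishing_order_def using not_less_Least by blast
      then show "foldr pd js f p = 0"
        using iterated_partial_derivative_of_real[OF f, of js] by (simp add: u)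
    qed
  qed
qed

section \<open>From projective points to the sphere\<close>

theorem proposition3:
  fixes n :: nat and u v :: "real^3 \<Rightarrow> complex"
  assumes "u \<in> harmonic_polynomials n" and "v \<in> harmonic_polynomials n"
    and "real_valued u" and "real_valued v"
    and "common_zero_count u v < \<infinity>"
  shows "common_zero_count u v \<le> enat (2 * n\<^sup>2)"
proof -
  obtain f where f: "f \<in> forms n" "u = (\<lambda>x. complex_of_real (f x))"
    "\<And>x. (\<Sum>i\<in>UNIV. pd i (pd i f) x) = 0" "\<And>p. vanish (vanishing_order u p) f p"
    by (rule real_harmonic_polynomialE[OF assms(1,3)]) blast
  obtain g where g: "g \<in> forms n" "v = (\<lambda>x. complex_of_real (g x))"
    "\<And>x. (\<Sum>i\<in>UNIV. pd i (pd i g) x) = 0" "\<And>p. vanish (vanishing_order v p) g p"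
    by (rule real_harmonic_polynomialE[OF assms(2,4)]) blast
  define Z where "Z = {x \<in> sphere 0 1. f x = 0 \<and> g x = 0}"
  have Z: "nodal_set u \<inter> nodal_set v = Z"
    by (auto simp: nodal_set_def Z_def f(2) g(2))
  have fin: "finite Z"
  proof (rule ccontr)
    assume "infinite Z"
    then have "common_zero_count u v = \<infinity>" unfolding common_zero_count_def Z by (rule if_not_P)
    then show False using assms(5) by simp
  qed
  let ?k = "vanishing_order u" and ?l = "vanishing_order v"
  have "(\<Sum>x\<in>Z. ?k x * ?l x) \<le> 2 * n\<^sup>2"
  proof (cases "n = 0")
    \<comment> \<open>In degree 0 both functions are constant, and a common zero would put the whole
      sphere into the finite set \<open>Z\<close>.\<close>
    case True
    have "Z = {}"
    proof (rule ccontr)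
      assume "Z \<noteq> {}"
      then obtain p where "f p = 0" "g p = 0" by (auto simp: Z_def)
      moreover have "f x = f p" "g x = g p" for x
        using f(1) g(1) unfolding True by (auto intro: forms_degree_0)
      ultimately have "f x = 0 \<and> g x = 0" for x by simp
      then have "Z = sphere 0 1" by (auto simp: Z_def)
      then show False using fin infinite_sphere_3 by simp
    qed
    then show ?thesis by simp
  next
    case False
    \<comment> \<open>If \<open>h = 0\<close>, then \<open>Z\<close> is the zero set of
      \<open>h'\<close>, which is infinite: either \<open>h' = 0\<close>, or the factorisation
      \<open>h' = h' * 1\<close> has a first factor of positive degree \<open>n\<close>.\<close>
    have nz: "\<exists>y. h y \<noteq> 0" if h: "h \<in> forms n" "\<And>x. (\<Sum>i\<in>UNIV. pd i (pd i h) x) = 0"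
      and h': "h' \<in> forms n" "\<And>x. (\<Sum>i\<in>UNIV. pd i (pd i h') x) = 0"
      and Zh: "Z = {x \<in> sphere 0 1. h x = 0 \<and> h' x = 0}" for h h'
    proof (rule ccontr)
      assume "\<not> (\<exists>y. h y \<noteq> 0)"
      then have Z': "Z = {x \<in> sphere 0 1. h' x = 0}" by (auto simp: Zh)
      show False
      proof (cases "\<exists>y. h' y \<noteq> 0")
        case True
        then obtain y where "h' y \<noteq> 0" by blast
        then have "infinite {x \<in> sphere 0 1. h' x = 0}"
          using False forms_const[of 1]
          by (intro harmonic_factor_infinite_zeros[OF h', of y n h' "\<lambda>x. 1"] h') auto
        then show False using fin Z' by simp
      next
        case False
        then have "Z = sphere 0 1" by (auto simp: Z')
        then show False using fin infinite_sphere_3 by simp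
      qed
    qed
    obtain y where y: "f y \<noteq> 0" using nz[OF f(1,3) g(1,3)] by (auto simp: Z_def)
    obtain z where z: "g z \<noteq> 0" using nz[OF g(1,3) f(1,3)] by (auto simp: Z_def)
    have no_common: False if "1 \<le> m" "m \<le> n" "w \<in> forms m" "a \<in> forms (n - m)" "b \<in> forms (n - m)"
      "\<And>x. f x = w x * a x" "\<And>x. g x = w x * b x" for m w a b
    proof -
      have "infinite {x \<in> sphere 0 1. w x = 0}"
        by (rule harmonic_factor_infinite_zeros[OF f(1,3) y that(1,2,3,4,6)])
      moreover have "{x \<in> sphere 0 1. w x = 0} \<subseteq> Z" by (auto simp: Z_def that(6,7))
      ultimately show False using fin finite_subset by blast
    qed
    have bezout: "(\<Sum>x\<in>T. ?k x * ?l x) \<le> n\<^sup>2" if T: "T \<subseteq> Z" "\<And>x. x \<in> T \<Longrightarrow> - x \<notin> T" for T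
    proof (rule bezout_forms[OF _ _ T(2) f(1) g(1) z f(4) g(4)])
      show "finite T" using T(1) fin finite_subset by blast
      show "norm p = 1" if "p \<in> T" for p using that T(1) by (auto simp: Z_def)
      show "\<exists>c\<in>forms m. \<forall>x. a x = g x * c x \<and> b x = - (f x * c x)"
        if "a \<in> forms (n + m)" "b \<in> forms (n + m)" "\<And>x. f x * a x + g x * b x = 0" for m a b
        by (rule syzygy_trivial[OF f(1) y g(1) z no_common that])
    qed auto
    txt \<open>\<open>H\<close> contains exactly one of two antipodal points.\<close>
    define H where "H = {x :: real^3. 0 < x $ 1 \<or> x $ 1 = 0 \<and> (0 < x $ 2 \<or> x $ 2 = 0 \<and> 0 < x $ 3)}"
    have H: "x \<in> H \<longleftrightarrow> - x \<notin> H" if "x \<in> Z" for x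
    proof -
      have "x \<noteq> 0" using that by (auto simp: Z_def)
      then show ?thesis by (auto simp: H_def vec_eq_iff forall_3)
    qed
    have "(\<Sum>x\<in>Z. ?k x * ?l x) = (\<Sum>x\<in>Z \<inter> H. ?k x * ?l x) + (\<Sum>x\<in>Z - H. ?k x * ?l x)"
      using fin by (subst sum.union_disjoint[symmetric]) (auto intro!: sum.cong)
    \<comment> \<open>Neither \<open>Z \<inter> H\<close> nor \<open>Z - H\<close> contains an
      antipodal pair, so \<open>bezout\<close> applies to each.\<close>
    also have "\<dots> \<le> n\<^sup>2 + n\<^sup>2"
      using H by (intro add_mono bezout) auto
    finally show ?thesis by simp
  qed
  then show ?thesis
    unfolding common_zero_count_def Z using fin by simp
qed

end
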